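(* Let $X=(X_1,X_2)$ be a joint distribution of two random variables taking values in finite sets. Then there is a log-convergent sequence $\{G_i\}_{i=1}^\infty$ of graphs in $\mathcal{B}_0$ such that every $G_i$ is edge-vertex transitive and $$\lim_{i\to\infty}h(H,G_i)=h^*(H,X)$$ holds for every $H\in\mathcal{B}_0$ without isolated vertices.
   Context: Bipartite setting. $\mathcal{B}$ is the set of (isomorphism classes of) finite graphs $H$ whose vertex set is partitioned into two labelled classes $V_1(H),V_2(H)$, with edge set $E(H)\subseteq V_1(H)\times V_2(H)$. Homomorphisms and automorphisms are required to preserve the labels $1,2$; $\mathrm{Hom}(H,G)$ is the set of homomorphisms from $H$ to $G$. $\mathcal{B}_0$ is the set of $G\in\mathcal{B}$ with $E(G)\neq\emptyset$. $P_1$ is the single edge. For $H\in\mathcal{B}$, $G\in\mathcal{B}_0$ put $t(H,G)=|\mathrm{Hom}(H,G)|\,|V_1(G)|^{-|V_1(H)|}|V_2(G)|^{-|V_2(H)|}$, $d(H,G)=-\log t(H,G)$, and, for $H,G\in\mathcal{B}_0$, $h(H,G)=d(H,G)/d(P_1,G)$; if $E(G)=V_1(G)\times V_2(G)$ (so $d(P_1,G)=0$), set $h(H,G):=|E(H)|$. A sequence $\{G_i\}$ in $\mathcal{B}_0$ is log-convergent if $\lim_{i\to\infty}h(H,G_i)$ exists (in $\mathbb{R}$) for every $H\in\mathcal{B}_0$. A graph $G\in\mathcal{B}_0$ is edge-vertex transitive if its (label preserving) automorphism group acts transitively on $E(G)$, on $V_1(G)$ and on $V_2(G)$. Information-theoretic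 quantities. Let $X=(X_1,X_2)$ be a joint distribution with $X_i$ taking values in a finite set $F_i$, and let $H\in\mathcal{B}_0$ have no isolated vertices. $Q(H,X)$ is the (non-empty) set of all joint distributions $\{X_v\}_{v\in V(H)}$, with $X_v$ taking values in $F_i$ for $v\in V_i(H)$, such that for every edge $(v,w)\in E(H)$ (with $v\in V_1(H)$, $w\in V_2(H)$) the pair $(X_v,X_w)$ has the same distribution as $(X_1,X_2)$. $\mathbb{H}$ denotes Shannon entropy (natural logarithm). $m(H,X)$ is the maximal entropy of an element of $Q(H,X)$, $d^*(H,X):=-m(H,X)+\sum_{i=1}^2|V_i(H)|\,\mathbb{H}(X_i)$, and $h^*(H,X):=d^*(H,X)/d^*(P_1,X)$; if $X_1,X_2$ are independent (so $d^*(P_1,X)=0$), set $h^*(H,X):=|E(H)|$. *)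

theory Defs
  imports "HOL-Probability.Probability" "HOL-Real_Asymp.Real_Asymp"
begin

record 'v bigraph =
  part1 :: "'v set"
  part2 :: "'v set"
  edges :: "('v \<times> 'v) set"

definition verts :: "'v bigraph \<Rightarrow> 'v set" where
  "verts G = part1 G \<union> part2 G"

definition bipartite_graph :: "'v bigraph \<Rightarrow> bool" where
  "bipartite_graph G \<longleftrightarrow>
     finite (part1 G) \<and> finite (part2 G) \<and> part1 G \<inter> part2 G = {} \<and>
     edges G \<subseteq> part1 G \<times> part2 G"

text \<open>Every finite graph is isomorphic to one whose vertices are natural numbers, so the
  following sets contain a representative of every isomorphism class.\<close>

definition \<B> :: "nat bigraph set" where
  "\<B> = {G. bipartite_graph G}"

definition \<B>\<^sub>0 :: "nat bigraph set" where
  "\<B>\<^sub>0 = {G \<in> \<B>. edges G \<noteq> {}}"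

definition P\<^sub>1 :: "nat bigraph" where
  "P\<^sub>1 = \<lparr>part1 = {0}, part2 = {1}, edges = {(0, 1)}\<rparr>"

definition no_isolated :: "'v bigraph \<Rightarrow> bool" where
  "no_isolated H \<longleftrightarrow>
     (\<forall>v \<in> part1 H. \<exists>w. (v, w) \<in> edges H) \<and> (\<forall>w \<in> part2 H. \<exists>v. (v, w) \<in> edges H)"

definition Hom :: "'v bigraph \<Rightarrow> 'w bigraph \<Rightarrow> ('v \<Rightarrow> 'w) set" where
  "Hom H G = {\<phi> \<in> verts H \<rightarrow>\<^sub>E verts G.
     \<phi> ` part1 H \<subseteq> part1 G \<and> \<phi> ` part2 H \<subseteq> part2 G \<and>
     (\<forall>(v, w) \<in> edges H. (\<phi> v, \<phi> w) \<in> edges G)}"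

definition Aut :: "'v bigraph \<Rightarrow> ('v \<Rightarrow> 'v) set" where
  "Aut G = {\<phi> \<in> extensional (verts G).
     bij_betw \<phi> (part1 G) (part1 G) \<and> bij_betw \<phi> (part2 G) (part2 G) \<and>
     (\<forall>v \<in> part1 G. \<forall>w \<in> part2 G. (\<phi> v, \<phi> w) \<in> edges G \<longleftrightarrow> (v, w) \<in> edges G)}"

definition edge_vertex_transitive :: "'v bigraph \<Rightarrow> bool" where
  "edge_vertex_transitive G \<longleftrightarrow>
     (\<forall>(v, w) \<in> edges G. \<forall>(v', w') \<in> edges G. \<exists>\<phi> \<in> Aut G. \<phi> v = v' \<and> \<phi> w = w') \<and>
     (\<forall>v \<in> part1 G. \<forall>v' \<in> part1 G. \<exists>\<phi> \<in> Aut G. \<phi> v = v') \<and>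
     (\<forall>w \<in> part2 G. \<forall>w' \<in> part2 G. \<exists>\<phi> \<in> Aut G. \<phi> w = w')"

definition hom_density :: "'v bigraph \<Rightarrow> 'w bigraph \<Rightarrow> real" where
  "hom_density H G = real (card (Hom H G)) /
     (real (card (part1 G)) ^ card (part1 H) * real (card (part2 G)) ^ card (part2 H))"

definition log_density :: "'v bigraph \<Rightarrow> 'w bigraph \<Rightarrow> real" where
  "log_density H G = - ln (hom_density H G)"

definition h :: "'v bigraph \<Rightarrow> 'w bigraph \<Rightarrow> real" where
  "h H G = (if edges G = part1 G \<times> part2 G then real (card (edges H))
            else log_density H G / log_density P\<^sub>1 G)"

definition log_convergent :: "(nat \<Rightarrow> nat bigraph) \<Rightarrow> bool" where
  "log_convergent G \<longleftrightarrow>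
     (\<forall>i. G i \<in> \<B>\<^sub>0) \<and> (\<forall>H \<in> \<B>\<^sub>0. convergent (\<lambda>i. h H (G i)))"

definition shannon_entropy :: "'x pmf \<Rightarrow> real" where
  "shannon_entropy p = - (\<Sum>x \<in> set_pmf p. pmf p x * ln (pmf p x))"

lemma shannon_entropy_superset:
  assumes "finite S" "set_pmf p \<subseteq> S"
  shows "shannon_entropy p = - (\<Sum>x\<in>S. pmf p x * ln (pmf p x))"
  unfolding shannon_entropy_def
  by (intro arg_cong[where f = uminus] sum.mono_neutral_left)
     (use assms in \<open>auto simp: set_pmf_iff\<close>)

text \<open>Agreement with the entropy of a finitely-valued random variable from the library
  (with logarithms to base \<open>exp 1\<close>).\<close>

lemma shannon_entropy_eq_entropy:
  fixes p :: "'x pmf" and Y :: "'x \<Rightarrow> 'y"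
  assumes "finite (range Y)"
  shows "prob_space.entropy (measure_pmf p) (exp 1) (count_space (range Y)) Y
           = shannon_entropy (map_pmf Y p)"
proof -
  interpret information_space "measure_pmf p" "exp 1"
    by unfold_locales simp
  have sf: "simple_function (measure_pmf p) Y"
    using assms by (simp add: simple_function_def)
  have "simple_distributed (measure_pmf p) Y (pmf (map_pmf Y p))"
    using sf by (intro measure_pmf.simple_distributedI) (auto simp: pmf_map)
  from entropy_simple_distributed[OF this]
  have "prob_space.entropy (measure_pmf p) (exp 1) (count_space (range Y)) Y
      = - (\<Sum>x\<in>range Y. pmf (map_pmf Y p) x * ln (pmf (map_pmf Y p) x))"
    by (simp add: log_def)
  also have "\<dots> = shannon_entropy (map_pmf Y p)"
    using assms by (intro shannon_entropy_superset[symmetric]) auto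
  finally show ?thesis .
qed

text \<open>A family \<open>{X\<^sub>v}\<close> indexed by the vertices of \<open>H\<close> is a random pair \<open>(f, g)\<close> of functions on
  the two classes of \<open>H\<close>.\<close>

definition Q :: "'a set \<Rightarrow> 'b set \<Rightarrow> 'v bigraph \<Rightarrow> ('a \<times> 'b) pmf \<Rightarrow> (('v \<Rightarrow> 'a) \<times> ('v \<Rightarrow> 'b)) pmf set" where
  "Q F1 F2 H X = {p. set_pmf p \<subseteq> (part1 H \<rightarrow>\<^sub>E F1) \<times> (part2 H \<rightarrow>\<^sub>E F2) \<and>
     (\<forall>(v, w) \<in> edges H. map_pmf (\<lambda>(f, g). (f v, g w)) p = X)}"

text \<open>The supremum is a maximum for finite \<open>F1\<close>, \<open>F2\<close> and bipartite \<open>H\<close>; see \<open>max_entropy_attained\<close> below.\<close>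

definition max_entropy :: "'a set \<Rightarrow> 'b set \<Rightarrow> 'v bigraph \<Rightarrow> ('a \<times> 'b) pmf \<Rightarrow> real" where
  "max_entropy F1 F2 H X = (SUP p \<in> Q F1 F2 H X. shannon_entropy p)"

definition dstar :: "'a set \<Rightarrow> 'b set \<Rightarrow> 'v bigraph \<Rightarrow> ('a \<times> 'b) pmf \<Rightarrow> real" where
  "dstar F1 F2 H X = - max_entropy F1 F2 H X
     + (real (card (part1 H)) * shannon_entropy (map_pmf fst X)
        + real (card (part2 H)) * shannon_entropy (map_pmf snd X))"

definition hstar :: "'a set \<Rightarrow> 'b set \<Rightarrow> 'v bigraph \<Rightarrow> ('a \<times> 'b) pmf \<Rightarrow> real" where
  "hstar F1 F2 H X =
     (if X = pair_pmf (map_pmf fst X) (map_pmf snd X) then real (card (edges H))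
      else dstar F1 F2 H X / dstar F1 F2 P\<^sub>1 X)"

lemma Q_nonempty:
  assumes "bipartite_graph H" "set_pmf X \<subseteq> F1 \<times> F2"
  shows "Q F1 F2 H X \<noteq> {}"
proof -
  let ?p = "map_pmf (\<lambda>(a, b). (\<lambda>v\<in>part1 H. a, \<lambda>w\<in>part2 H. b)) X"
  have "map_pmf (\<lambda>(f, g). (f v, g w)) ?p = X" if "(v, w) \<in> edges H" for v w
  proof -
    have "v \<in> part1 H" "w \<in> part2 H"
      using assms that by (auto simp: bipartite_graph_def)
    then show ?thesis
      by (simp add: map_pmf_comp case_prod_unfold)
  qed
  moreover have "set_pmf ?p \<subseteq> (part1 H \<rightarrow>\<^sub>E F1) \<times> (part2 H \<rightarrow>\<^sub>E F2)"
    using assms(2) by fastforce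
  ultimately have "?p \<in> Q F1 F2 H X"
    unfolding Q_def by blast
  then show ?thesis by blast
qed

lemma continuous_on_xlnx: "continuous_on {0..} (\<lambda>x::real. x * ln x)"
  unfolding continuous_on_eq_continuous_within
proof
  fix x :: real assume x: "x \<in> {0..}"
  show "continuous (at x within {0..}) (\<lambda>x. x * ln x)"
  proof (cases "x = 0")
    case True
    have "((\<lambda>x::real. x * ln x) \<longlongrightarrow> 0) (at_right 0)"
      by real_asymp
    moreover have "at (0::real) within {0..} = at_right 0"
      by (rule at_within_Ici_at_right)
    ultimately show ?thesis using True by (simp add: continuous_within)
  next
    case False
    with x show ?thesis by (intro continuous_intros) auto
  qed
qed

lemma pmf_entropy_attained:
  fixes I :: "'i set" and g :: "'i \<Rightarrow> 'x \<Rightarrow> 'y" and X :: "'y pmf" and S :: "'x set"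
  defines "A \<equiv> {p. set_pmf p \<subseteq> S \<and> (\<forall>i\<in>I. map_pmf (g i) p = X)}"
  assumes S: "finite S" and ne: "A \<noteq> {}"
  shows "\<exists>p\<in>A. \<forall>q\<in>A. shannon_entropy q \<le> shannon_entropy p"
proof -
  define T :: "'x \<Rightarrow> real set" where "T = (\<lambda>x. if x \<in> S then {0..1} else {0})"
  define K where "K = PiE UNIV T"
  define C where "C = K \<inter> {q. sum q S = 1} \<inter>
     (\<Inter>i\<in>I. \<Inter>y. {q. (\<Sum>x\<in>{x\<in>S. g i x = y}. q x) = pmf X y})"
  have "compactin (product_topology (\<lambda>_. euclidean) UNIV) (PiE UNIV T)"
    by (subst compactin_PiE) (auto simp: T_def)
  then have "compact K"
    by (simp add: K_def euclidean_product_topology)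
  have coord: "continuous_on UNIV (\<lambda>q::'x \<Rightarrow> real. q x)" for x
    by (rule continuous_on_product_coordinates)
  have "compact C"
    unfolding C_def Int_assoc
    by (intro compact_Int_closed \<open>compact K\<close> closed_Int closed_INT ballI closed_Collect_eq
        continuous_on_sum continuous_on_const coord)
  have mem: "pmf p \<in> C" if "p \<in> A" for p
  proof -
    have sub: "set_pmf p \<subseteq> S" and m: "\<And>i. i \<in> I \<Longrightarrow> map_pmf (g i) p = X"
      using that by (auto simp: A_def)
    have "pmf p \<in> K"
      using sub by (auto simp: K_def T_def pmf_le_1 set_pmf_iff)
    moreover have "sum (pmf p) S = 1"
      using S sub by (rule sum_pmf_eq_1)
    moreover have "(\<Sum>x\<in>{x\<in>S. g i x = y}. pmf p x) = pmf X y" if "i \<in> I" for i y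
    proof -
      have "pmf X y = measure (measure_pmf p) (g i -` {y})"
        using m[OF that] by (metis pmf_map)
      also have "\<dots> = measure (measure_pmf p) {x\<in>S. g i x = y}"
        using sub by (intro measure_pmf.finite_measure_eq_AE) (auto simp: AE_measure_pmf_iff)
      also have "\<dots> = (\<Sum>x\<in>{x\<in>S. g i x = y}. pmf p x)"
        using S by (simp add: measure_measure_pmf_finite)
      finally show ?thesis by simp
    qed
    ultimately show ?thesis by (auto simp: C_def)
  qed
  have C0: "q x \<ge> 0" "x \<notin> S \<Longrightarrow> q x = 0" if "q \<in> C" for q x
  proof -
    have "q x \<in> T x" using that by (auto simp: C_def K_def)
    then show "q x \<ge> 0" "x \<notin> S \<Longrightarrow> q x = 0"
      by (auto simp: T_def split: if_splits)
  qed
  have ex: "\<exists>p\<in>A. pmf p = q" if "q \<in> C" for q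
  proof -
    note q0 = C0[OF that]
    have "(\<integral>\<^sup>+x. ennreal (q x) \<partial>count_space UNIV) = (\<Sum>x\<in>S. ennreal (q x))"
      using S q0 by (intro nn_integral_count_space') auto
    also have "\<dots> = 1"
      using that q0 by (simp add: C_def)
    finally have int: "(\<integral>\<^sup>+x. ennreal (q x) \<partial>count_space UNIV) = 1" .
    have pm: "pmf (embed_pmf q) = q"
      by (rule ext, rule pmf_embed_pmf) (use q0 int in auto)
    have sub: "set_pmf (embed_pmf q) \<subseteq> S"
      using q0(2) unfolding set_pmf_eq pm by blast
    have "map_pmf (g i) (embed_pmf q) = X" if "i \<in> I" for i
    proof (rule pmf_eqI)
      fix y
      have "pmf (map_pmf (g i) (embed_pmf q)) y = measure (measure_pmf (embed_pmf q)) (g i -` {y})"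
        by (simp add: pmf_map)
      also have "\<dots> = measure (measure_pmf (embed_pmf q)) {x\<in>S. g i x = y}"
        using sub by (intro measure_pmf.finite_measure_eq_AE) (auto simp: AE_measure_pmf_iff)
      also have "\<dots> = (\<Sum>x\<in>{x\<in>S. g i x = y}. q x)"
        using S by (simp add: measure_measure_pmf_finite pm)
      also have "\<dots> = pmf X y"
        using \<open>q \<in> C\<close> that by (auto simp: C_def)
      finally show "pmf (map_pmf (g i) (embed_pmf q)) y = pmf X y" .
    qed
    with sub pm show ?thesis by (auto simp: A_def)
  qed
  have cont: "continuous_on C (\<lambda>q. - (\<Sum>x\<in>S. q x * ln (q x)))"
  proof (intro continuous_on_minus continuous_on_sum)
    fix x assume "x \<in> S"
    have "(\<lambda>q. q x) ` C \<subseteq> {0..}"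
      using C0(1) by auto
    then show "continuous_on C (\<lambda>q. q x * ln (q x))"
      by (intro continuous_on_compose2[OF continuous_on_xlnx] continuous_on_subset[OF coord]) auto
  qed
  have "C \<noteq> {}" using ne mem by auto
  from continuous_attains_sup[OF \<open>compact C\<close> this cont] obtain q where
    q: "q \<in> C" "\<And>r. r \<in> C \<Longrightarrow> - (\<Sum>x\<in>S. r x * ln (r x)) \<le> - (\<Sum>x\<in>S. q x * ln (q x))"
    by blast
  from ex[OF q(1)] obtain p where p: "p \<in> A" "pmf p = q" by blast
  have H: "shannon_entropy r = - (\<Sum>x\<in>S. pmf r x * ln (pmf r x))" if "r \<in> A" for r
    using that S by (intro shannon_entropy_superset) (auto simp: A_def)
  have "shannon_entropy r \<le> shannon_entropy p" if "r \<in> A" for r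
    unfolding H[OF that] H[OF p(1)] p(2) using mem[OF that] by (rule q(2))
  with p(1) show ?thesis by blast
qed

lemma max_entropy_attained:
  assumes "bipartite_graph H" "finite F1" "finite F2" "set_pmf X \<subseteq> F1 \<times> F2"
  obtains p where "p \<in> Q F1 F2 H X" "shannon_entropy p = max_entropy F1 F2 H X"
    "\<And>q. q \<in> Q F1 F2 H X \<Longrightarrow> shannon_entropy q \<le> max_entropy F1 F2 H X"
proof -
  let ?S = "(part1 H \<rightarrow>\<^sub>E F1) \<times> (part2 H \<rightarrow>\<^sub>E F2)"
  let ?g = "\<lambda>e (f, g). (f (fst e), g (snd e))"
  have eq: "Q F1 F2 H X = {p. set_pmf p \<subseteq> ?S \<and> (\<forall>e\<in>edges H. map_pmf (?g e) p = X)}"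
    unfolding Q_def by (simp add: case_prod_unfold)
  have "finite ?S"
    using assms by (simp add: bipartite_graph_def finite_PiE)
  moreover have "{p. set_pmf p \<subseteq> ?S \<and> (\<forall>e\<in>edges H. map_pmf (?g e) p = X)} \<noteq> {}"
    using Q_nonempty[OF assms(1,4)] unfolding eq .
  ultimately have "\<exists>p\<in>Q F1 F2 H X. \<forall>q\<in>Q F1 F2 H X. shannon_entropy q \<le> shannon_entropy p"
    unfolding eq by (rule pmf_entropy_attained)
  then obtain p where p: "p \<in> Q F1 F2 H X"
    "\<And>q. q \<in> Q F1 F2 H X \<Longrightarrow> shannon_entropy q \<le> shannon_entropy p"
    by blast
  have "max_entropy F1 F2 H X = shannon_entropy p"
    unfolding max_entropy_def using p by (intro cSup_eq_maximum) auto
  with p that show ?thesis by simp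
qed

end

theory Submission
  imports Defs "HOL-Combinatorics.Multiset_Permutations"
begin

text \<open>
  If \<open>X\<close> is independent, the constant sequence \<open>P\<^sub>1\<close> works. Otherwise let the vertices of \<open>G\<^sub>i\<close> be the
  sequences of length \<open>n\<^sub>i\<close> whose empirical distributions approximate \<open>X\<^sub>1\<close> and \<open>X\<^sub>2\<close>, two sequences
  being adjacent iff their joint type is a fixed approximation \<open>A\<^sub>i\<close> of \<open>n\<^sub>i X\<close>. Permuting positions
  makes this graph edge-vertex transitive. A homomorphism from \<open>H\<close> is a sequence of labellings of \<open>H\<close>
  all of whose edge marginals have type \<open>A\<^sub>i\<close>, so up to a polynomial factor the number of
  homomorphisms is the exponential of \<open>n\<^sub>i\<close> times the maximal entropy of an element of \<open>Q(H, A\<^sub>i/n\<^sub>i)\<close>.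

  By compactness these maxima are asymptotically at most the one for \<open>X\<close>. For the converse, a simultaneous
  Dirichlet approximation provides \<open>n\<^sub>i\<close> for which the values of \<open>n\<^sub>i X\<close> and of \<open>n\<^sub>i p\<^sub>H\<close> (\<open>p\<^sub>H\<close> a maximiser
  in \<open>Q(H, X)\<close>) are all very close to integers, for every \<open>H\<close> on \<open>{0,\<dots>,i-1}\<close>; the marginal constraints have
  integer coefficients, so they survive rounding.
\<close>

section \<open>Counting sequences of a given type\<close>

text \<open>Elementary Stirling bound by induction: the step from \<open>n\<close> to
  \<open>n + 1\<close> amounts to \<open>n * (ln (n + 1) - ln n) \<le> 1\<close>, which is
  \<open>ln (1 + 1 / n) \<le> 1 / n\<close>.\<close>

lemma ln_fact_ge: "real n * ln (real n) - real n \<le> ln (fact n)"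
proof (induction n)
  case (Suc n)
  show ?case
  proof (cases "n = 0")
    case False
    have "ln (1 + 1 / real n) \<le> 1 / real n"
      using False by (intro ln_add_one_self_le_self) auto
    moreover have "1 + 1 / real n = real (Suc n) / real n"
      using False by (simp add: field_simps)
    ultimately have "ln (real (Suc n)) - ln (real n) \<le> 1 / real n"
      using False by (simp add: ln_div)
    then have "real n * (ln (real (Suc n)) - ln (real n)) \<le> 1"
      using False by (simp add: field_simps)
    moreover have "ln (fact (Suc n)) = ln (real (Suc n)) + ln (fact n)"
      by (simp add: ln_mult del: of_nat_Suc)
    ultimately show ?thesis
      using Suc by (simp add: algebra_simps)
  qed simp
qed simp

text \<open>The step is the reverse estimate \<open>(n + 1) * (ln (n + 1) - ln n) \<ge> 1\<close>.
  The gap \<open>1 + ln n\<close> to the lower bound is the error charged to each factorial in the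
  next lemma.\<close>

lemma ln_fact_le: "n \<ge> 1 \<Longrightarrow> ln (fact n) \<le> real n * ln (real n) - real n + 1 + ln (real n)"
proof (induction n rule: dec_induct)
  case (step n)
  have "ln (1 - 1 / real (Suc n)) \<le> - 1 / real (Suc n)"
    using ln_le_minus_one[of "1 - 1 / real (Suc n)"] step by (simp add: field_simps)
  moreover have "1 - 1 / real (Suc n) = real n / real (Suc n)"
    by (simp add: field_simps)
  ultimately have "ln (real n) - ln (real (Suc n)) \<le> - 1 / real (Suc n)"
    using step by (simp add: ln_div)
  then have "real (Suc n) * (ln (real (Suc n)) - ln (real n)) \<ge> 1"
    by (simp add: field_simps)
  moreover have "ln (fact (Suc n)) = ln (real (Suc n)) + ln (fact n)"
    by (simp add: ln_mult del: of_nat_Suc)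
  ultimately show ?case
    using step by (simp add: algebra_simps)
qed simp

text \<open>The cardinality is a multinomial coefficient, and \<open>pmf_of_multiset R\<close> is
  the empirical distribution. With Stirling's bounds for all factorials, the linear terms cancel
  because the counts add up to the size. At most \<open>card S + 1\<close> factorials remain, each
  with an error of at most \<open>1 + ln (size R)\<close>.\<close>

lemma ln_card_permutations_of_multiset:
  assumes S: "finite S" "set_mset R \<subseteq> S" and ne: "R \<noteq> {#}"
  shows "\<bar>ln (real (card (permutations_of_multiset R)))
           - real (size R) * shannon_entropy (pmf_of_multiset R)\<bar>
         \<le> (real (card S) + 1) * (1 + ln (real (size R)))"
proof -
  let ?n = "real (size R)" and ?c = "\<lambda>x. real (count R x)"
  have n: "?n \<ge> 1" using ne by (simp add: Suc_le_eq nonempty_has_size)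
  have pos: "?c x \<ge> 1" if "x \<in> set_mset R" for x
    using that by (simp add: Suc_le_eq)
  have sz: "?n = (\<Sum>x\<in>set_mset R. ?c x)"
    by (simp add: size_multiset_overloaded_eq)
  have "real (card (permutations_of_multiset R)) * (\<Prod>x\<in>set_mset R. fact (count R x)) = fact (size R)"
    using arg_cong[OF card_permutations_of_multiset_aux[of R], of real] by simp
  then have "ln (fact (size R)) = ln (real (card (permutations_of_multiset R))
      * (\<Prod>x\<in>set_mset R. fact (count R x)))" by simp
  also have "\<dots> = ln (real (card (permutations_of_multiset R)))
      + ln (\<Prod>x\<in>set_mset R. fact (count R x) :: real)"
    by (rule ln_mult_pos) (auto simp: card_gt_0_iff intro!: prod_pos)
  also have "ln (\<Prod>x\<in>set_mset R. fact (count R x) :: real) = (\<Sum>x\<in>set_mset R. ln (fact (count R x)))"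
    by (intro ln_prod) auto
  finally have 1: "ln (real (card (permutations_of_multiset R)))
      = ln (fact (size R)) - (\<Sum>x\<in>set_mset R. ln (fact (count R x)))" by simp
  have "?n * shannon_entropy (pmf_of_multiset R) = - (\<Sum>x\<in>set_mset R. ?c x * ln (?c x / ?n))"
    using ne n by (simp add: shannon_entropy_def sum_distrib_left)
  also have "(\<Sum>x\<in>set_mset R. ?c x * ln (?c x / ?n))
      = (\<Sum>x\<in>set_mset R. ?c x * ln (?c x) - ?c x * ln ?n)"
  proof (intro sum.cong refl)
    fix x assume "x \<in> set_mset R"
    then show "?c x * ln (?c x / ?n) = ?c x * ln (?c x) - ?c x * ln ?n"
      using pos[of x] n by (subst ln_div) (auto simp: algebra_simps)
  qed
  also have "\<dots> = (\<Sum>x\<in>set_mset R. ?c x * ln (?c x)) - ?n * ln ?n"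
    by (simp add: sum_subtractf sz sum_distrib_right)
  finally have 2: "?n * shannon_entropy (pmf_of_multiset R)
      = ?n * ln ?n - (\<Sum>x\<in>set_mset R. ?c x * ln (?c x))" by simp
  have 3: "?n * ln ?n - ?n \<le> ln (fact (size R))"
    by (rule ln_fact_ge)
  have 4: "ln (fact (size R)) \<le> ?n * ln ?n - ?n + 1 + ln ?n"
    using n by (intro ln_fact_le) auto
  have "(\<Sum>x\<in>set_mset R. ?c x * ln (?c x) - ?c x) \<le> (\<Sum>x\<in>set_mset R. ln (fact (count R x)))"
    by (intro sum_mono ln_fact_ge)
  then have 5: "(\<Sum>x\<in>set_mset R. ?c x * ln (?c x)) - ?n \<le> (\<Sum>x\<in>set_mset R. ln (fact (count R x)))"
    by (simp add: sum_subtractf sz)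
  have "(\<Sum>x\<in>set_mset R. ln (fact (count R x)))
      \<le> (\<Sum>x\<in>set_mset R. (?c x * ln (?c x) - ?c x) + (1 + ln ?n))"
  proof (intro sum_mono)
    fix x assume x: "x \<in> set_mset R"
    have "ln (fact (count R x)) \<le> ?c x * ln (?c x) - ?c x + 1 + ln (?c x)"
      using pos[OF x] by (intro ln_fact_le) auto
    moreover have "ln (?c x) \<le> ln ?n"
      using pos[OF x] n by (intro ln_mono) (auto simp: count_le_size)
    ultimately show "ln (fact (count R x)) \<le> (?c x * ln (?c x) - ?c x) + (1 + ln ?n)"
      by simp
  qed
  also have "\<dots> = (\<Sum>x\<in>set_mset R. ?c x * ln (?c x)) - ?n + real (card (set_mset R)) * (1 + ln ?n)"
    by (subst sum.distrib) (simp add: sum_subtractf sz)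
  also have "\<dots> \<le> (\<Sum>x\<in>set_mset R. ?c x * ln (?c x)) - ?n + real (card S) * (1 + ln ?n)"
    using n S by (intro add_left_mono mult_right_mono) (auto intro: card_mono)
  finally have 6: "(\<Sum>x\<in>set_mset R. ln (fact (count R x)))
      \<le> (\<Sum>x\<in>set_mset R. ?c x * ln (?c x)) - ?n + real (card S) * (1 + ln ?n)" .
  have 7: "0 \<le> ln ?n" "0 \<le> real (card S) * (1 + ln ?n)"
    using n by auto
  show ?thesis
    unfolding 1 2 using 3 4 5 6 7 by (simp add: distrib_right)
qed

text \<open>A multiset over \<open>S\<close> is determined by its counts on \<open>S\<close>, each
  of which lies in \<open>{..n}\<close>. Hence the number of types is polynomial in
  \<open>n\<close>, which is negligible on the exponential scale.\<close>

lemma finite_multisets_size: 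
  assumes "finite S"
  shows "finite {R. set_mset R \<subseteq> S \<and> size R = n}"
    and "card {R. set_mset R \<subseteq> S \<and> size R = n} \<le> (n + 1) ^ card S"
proof -
  let ?f = "\<lambda>R. restrict (count R) S"
  have inj: "inj_on ?f {R. set_mset R \<subseteq> S \<and> size R = n}"
  proof (intro inj_onI multiset_eqI)
    fix R R' x assume *: "R \<in> {R. set_mset R \<subseteq> S \<and> size R = n}"
      "R' \<in> {R. set_mset R \<subseteq> S \<and> size R = n}" "?f R = ?f R'"
    show "count R x = count R' x"
    proof (cases "x \<in> S")
      case True
      then show ?thesis using fun_cong[OF *(3), of x] by simp
    next
      case False
      then have "x \<notin># R" "x \<notin># R'" using * by auto
      then show ?thesis by (simp add: not_in_iff)
    qed
  qed
  have sub: "?f ` {R. set_mset R \<subseteq> S \<and> size R = n} \<subseteq> S \<rightarrow>\<^sub>E {..n}"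
    by (auto simp: count_le_size)
  have fin: "finite (S \<rightarrow>\<^sub>E {..n})" using assms by (simp add: finite_PiE)
  from inj_on_finite[OF inj sub fin]
  show "finite {R. set_mset R \<subseteq> S \<and> size R = n}" .
  have "card {R. set_mset R \<subseteq> S \<and> size R = n} \<le> card (S \<rightarrow>\<^sub>E {..n})"
    using inj sub fin by (rule card_inj_on_le)
  also have "\<dots> = (n + 1) ^ card S"
    using assms by (simp add: card_PiE)
  finally show "card {R. set_mset R \<subseteq> S \<and> size R = n} \<le> (n + 1) ^ card S" .
qed

lemma shannon_entropy_map_pmf_inj:
  assumes "inj_on f (set_pmf p)"
  shows "shannon_entropy (map_pmf f p) = shannon_entropy p"
  unfolding shannon_entropy_def using assms
  by (simp add: sum.reindex pmf_map_inj)

section \<open>Rounding and continuity of entropy\<close>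

text \<open>Dirichlet's theorem bounds the denominator \<open>q\<close> below only by 1. Applying it
  to the multiples \<open>Suc K * y\<close> and taking \<open>n = q * Suc K\<close> makes the
  denominator larger than \<open>K\<close> as well.\<close>

lemma simultaneous_approximation:
  fixes Y :: "real set"
  assumes "finite Y" "\<epsilon> > 0"
  obtains n :: nat where "n > K" "\<And>y. y \<in> Y \<Longrightarrow> \<bar>real n * y - of_int (round (real n * y))\<bar> < \<epsilon>"
proof -
  obtain m and e :: "nat \<Rightarrow> real" where Y: "Y = e ` {i. i < m}"
    using finite_imp_nat_seg_image_inj_on[OF assms(1)] by blast
  obtain N :: nat where N: "N > 0" "1 / real N < \<epsilon>"
    using nat_approx_posE[OF assms(2)] by (metis zero_less_Suc)
  obtain q p where q: "0 < q"
    and p: "\<And>i. i < m \<Longrightarrow> \<bar>of_int q * (real (Suc K) * e i) - of_int (p i)\<bar> < 1 / N"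
    using Dirichlet_approx_simult[OF N(1), of m "\<lambda>i. real (Suc K) * e i"] by metis
  define n where "n = nat q * Suc K"
  have n: "real n = of_int q * real (Suc K)" using q by (simp add: n_def del: of_nat_Suc mult_Suc_right)
  have "\<bar>real n * y - of_int (round (real n * y))\<bar> < \<epsilon>" if "y \<in> Y" for y
  proof -
    from that obtain i where i: "i < m" "y = e i" using Y by auto
    have "\<bar>real n * y - of_int (round (real n * y))\<bar> \<le> \<bar>real n * y - of_int (p i)\<bar>"
      by (rule round_diff_minimal)
    also have "\<dots> < 1 / N" using p[OF i(1)] by (simp add: n i mult.assoc)
    finally show ?thesis using N by simp
  qed
  moreover have "n > K"
  proof -
    have "1 * Suc K \<le> n" unfolding n_def using q by (intro mult_right_mono) auto
    then show ?thesis by simp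
  qed
  ultimately show ?thesis using that by blast
qed

section \<open>Rounding distributions to multisets, and semicontinuity of the maximal
  entropy\<close>

lemma pmf_map_finite_support:
  assumes "finite S" "set_pmf p \<subseteq> S"
  shows "pmf (map_pmf g p) y = (\<Sum>x | x \<in> S \<and> g x = y. pmf p x)"
proof -
  have "pmf (map_pmf g p) y = measure (measure_pmf p) (g -` {y})"
    by (simp add: pmf_map)
  also have "\<dots> = measure (measure_pmf p) {x\<in>S. g x = y}"
    using assms by (intro measure_pmf.finite_measure_eq_AE) (auto simp: AE_measure_pmf_iff)
  also have "\<dots> = (\<Sum>x | x \<in> S \<and> g x = y. pmf p x)"
    using assms by (simp add: measure_measure_pmf_finite)
  finally show ?thesis .
qed

lemma count_image_mset_superset:
  assumes "finite S" "set_mset R \<subseteq> S"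
  shows "count (image_mset g R) y = (\<Sum>x | x \<in> S \<and> g x = y. count R x)"
  unfolding count_image_mset using assms
  by (intro sum.mono_neutral_left) (auto simp: count_eq_zero_iff)

text \<open>The size need not be \<open>n\<close>; it is when all values \<open>n * pmf p x\<close>
  are close enough to integers. For an infinite support the sum would be empty by convention, hence
  the finiteness assumptions below.\<close>

definition round_mset :: "nat \<Rightarrow> 'x pmf \<Rightarrow> 'x multiset" where
  "round_mset n p = (\<Sum>x\<in>set_pmf p. replicate_mset (nat (round (real n * pmf p x))) x)"

lemma count_round_mset:
  assumes "finite (set_pmf p)"
  shows "count (round_mset n p) x = nat (round (real n * pmf p x))"
proof -
  have "count (round_mset n p) x
      = (\<Sum>y\<in>set_pmf p. if x = y then nat (round (real n * pmf p y)) else 0)"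
    unfolding round_mset_def count_sum by (intro sum.cong) auto
  also have "\<dots> = nat (round (real n * pmf p x))"
    using assms by (simp add: set_pmf_iff)
  finally show ?thesis .
qed

lemma set_round_mset:
  assumes "finite (set_pmf p)"
  shows "set_mset (round_mset n p) \<subseteq> set_pmf p"
proof
  fix x assume "x \<in># round_mset n p"
  then have "nat (round (real n * pmf p x)) > 0"
    using assms by (simp add: count_round_mset flip: count_greater_zero_iff)
  then show "x \<in> set_pmf p" by (auto simp: set_pmf_iff)
qed

lemma round_nonneg: "(x::real) \<ge> 0 \<Longrightarrow> round x \<ge> 0"
  using round_mono[of 0 x] by simp

text \<open>Both sides of a marginal constraint become integers after rounding, and they differ by less
  than 1, so the rounded counts satisfy the constraint exactly.\<close>

lemma image_round_mset:
  assumes S: "finite S" "set_pmf p \<subseteq> S" and q: "map_pmf g p = q"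
    and p_near: "\<And>x. \<bar>real n * pmf p x - of_int (round (real n * pmf p x))\<bar> < 1 / (real (card S) + 1)"
    and q_near: "\<And>y. \<bar>real n * pmf q y - of_int (round (real n * pmf q y))\<bar> < 1 / (real (card S) + 1)"
  shows "image_mset g (round_mset n p) = round_mset n q"
proof (rule multiset_eqI)
  fix y
  let ?T = "{x. x \<in> S \<and> g x = y}" and ?r = "\<lambda>x. round (real n * pmf p x)"
  let ?\<epsilon> = "1 / (real (card S) + 1)"
  have fp: "finite (set_pmf p)" using S finite_subset by blast
  have fq: "finite (set_pmf q)" using fp by (simp add: q[symmetric])
  have "count (image_mset g (round_mset n p)) y = (\<Sum>x\<in>?T. nat (?r x))"
    using S set_round_mset[OF fp, of n]
    by (subst count_image_mset_superset[of S]) (auto simp: count_round_mset[OF fp])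
  then have 1: "int (count (image_mset g (round_mset n p)) y) = (\<Sum>x\<in>?T. ?r x)"
    by (simp add: round_nonneg)
  have 2: "int (count (round_mset n q) y) = round (real n * pmf q y)"
    by (simp add: count_round_mset[OF fq] round_nonneg)
  have "\<bar>(\<Sum>x\<in>?T. of_int (?r x)) - real n * pmf q y\<bar>
      = \<bar>\<Sum>x\<in>?T. of_int (?r x) - real n * pmf p x\<bar>"
    by (simp add: q[symmetric] pmf_map_finite_support[OF S] sum_subtractf sum_distrib_left)
  also have "\<dots> \<le> (\<Sum>x\<in>?T. \<bar>of_int (?r x) - real n * pmf p x\<bar>)"
    by (rule sum_abs)
  also have "\<dots> \<le> (\<Sum>x\<in>?T. ?\<epsilon>)"
    using p_near by (intro sum_mono) (simp add: abs_minus_commute less_imp_le)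
  also have "\<dots> \<le> real (card S) * ?\<epsilon>"
    using S by (auto intro!: divide_right_mono card_mono)
  \<comment> \<open>The fibre of \<open>y\<close> contributes at most \<open>card S\<close> rounding
    errors and the value of \<open>q\<close> one more; the denominator \<open>card S + 1\<close>
    keeps their total below 1.\<close>
  finally have "\<bar>(\<Sum>x\<in>?T. of_int (?r x)) - of_int (round (real n * pmf q y))\<bar>
      < real (card S) * ?\<epsilon> + ?\<epsilon>"
    using q_near[of y] by linarith
  also have "\<dots> = 1" by (simp add: field_simps)
  finally have "\<bar>real_of_int ((\<Sum>x\<in>?T. ?r x) - round (real n * pmf q y))\<bar> < 1"
    by simp
  then have "(\<Sum>x\<in>?T. ?r x) = round (real n * pmf q y)" by linarith
  then show "count (image_mset g (round_mset n p)) y = count (round_mset n q) y"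
    using 1 2 by simp
qed

text \<open>The size is itself a marginal, namely the one under the map to a one-point space. There
  the scaled mass is exactly the integer \<open>n\<close>, so the preceding lemma applies.\<close>

lemma size_round_mset:
  assumes S: "finite S" "set_pmf p \<subseteq> S"
    and p_near: "\<And>x. \<bar>real n * pmf p x - of_int (round (real n * pmf p x))\<bar> < 1 / (real (card S) + 1)"
  shows "size (round_mset n p) = n"
proof -
  have "round (real n) = int n" by (rule round_of_nat)
  then have "image_mset (\<lambda>_. ()) (round_mset n p) = round_mset n (return_pmf ())"
    using p_near by (intro image_round_mset[OF S]) auto
  then have "size (round_mset n p) = size (round_mset n (return_pmf ()))"
    by (metis size_image_mset)
  then show ?thesis by (simp add: round_mset_def)
qed

text \<open>Upper semicontinuity of the maximal entropy in the marginals. The distributions on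
  \<open>S\<close> with entropy at least \<open>m\<close> form a compact set. On it the total
  deviation of the marginals from \<open>X\<close> is continuous and never zero, so it is bounded
  below by a positive \<open>\<delta>\<close>.\<close>

lemma shannon_entropy_less_near_marginals:
  fixes g :: "'i \<Rightarrow> 'x \<Rightarrow> 'y" and X :: "'y pmf"
  assumes S: "finite S" and Y: "finite Y" "\<And>i. i \<in> I \<Longrightarrow> g i ` S \<subseteq> Y" "set_pmf X \<subseteq> Y"
    and I: "finite I"
    and less: "\<And>p. set_pmf p \<subseteq> S \<Longrightarrow> (\<And>i. i \<in> I \<Longrightarrow> map_pmf (g i) p = X) \<Longrightarrow> shannon_entropy p < m"
  obtains \<delta> where "\<delta> > 0"
    "\<And>p. set_pmf p \<subseteq> S \<Longrightarrow>
      (\<Sum>i\<in>I. \<Sum>y\<in>Y. \<bar>pmf (map_pmf (g i) p) y - pmf X y\<bar>) < \<delta> \<Longrightarrow> shannon_entropy p < m"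
proof -
  \<comment> \<open>The factors outside \<open>S\<close> are the single point 0, so the product over
    the whole type is compact by Tychonoff. Together with total mass 1 on \<open>S\<close> it
    consists exactly of the mass functions of distributions supported in \<open>S\<close>.\<close>
  define T :: "'x \<Rightarrow> real set" where "T = (\<lambda>x. if x \<in> S then {0..1} else {0})"
  define C where "C = PiE UNIV T \<inter> {q. sum q S = 1}"
  define ent where "ent = (\<lambda>q::'x \<Rightarrow> real. - (\<Sum>x\<in>S. q x * ln (q x)))"
  define C' where "C' = C \<inter> ent -` {m..}"
  define D where
    "D = (\<lambda>q::'x \<Rightarrow> real. \<Sum>i\<in>I. \<Sum>y\<in>Y. \<bar>(\<Sum>x | x \<in> S \<and> g i x = y. q x) - pmf X y\<bar>)"
  have "compactin (product_topology (\<lambda>_. euclidean) UNIV) (PiE UNIV T)"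
    by (subst compactin_PiE) (auto simp: T_def)
  then have "compact (PiE UNIV T)"
    by (simp add: euclidean_product_topology)
  have coord: "continuous_on A (\<lambda>q::'x \<Rightarrow> real. q x)" for A x
    by (rule continuous_on_subset[OF continuous_on_product_coordinates]) auto
  have "compact C"
    unfolding C_def by (intro compact_Int_closed \<open>compact (PiE UNIV T)\<close> closed_Collect_eq
        continuous_on_sum continuous_on_const coord)
  have C0: "q x \<ge> 0" "x \<notin> S \<Longrightarrow> q x = 0" if "q \<in> C" for q x
  proof -
    have "q x \<in> T x" using that by (auto simp: C_def)
    then show "q x \<ge> 0" "x \<notin> S \<Longrightarrow> q x = 0"
      by (auto simp: T_def split: if_splits)
  qed
  have "continuous_on C ent"
    unfolding ent_def
  proof (intro continuous_on_minus continuous_on_sum)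
    fix x
    have "(\<lambda>q. q x) ` C \<subseteq> {0..}"
      using C0(1) by auto
    then show "continuous_on C (\<lambda>q. q x * ln (q x))"
      by (intro continuous_on_compose2[OF continuous_on_xlnx] coord) auto
  qed
  then have "closedin (top_of_set C) C'"
    unfolding C'_def by (rule continuous_closedin_preimage) simp
  with \<open>compact C\<close> have "compact C'"
    by (rule closedin_compact)
  have entC: "ent (pmf p) = shannon_entropy p" if "set_pmf p \<subseteq> S" for p
    using that S by (simp add: ent_def shannon_entropy_superset)
  have DC: "D (pmf p) = (\<Sum>i\<in>I. \<Sum>y\<in>Y. \<bar>pmf (map_pmf (g i) p) y - pmf X y\<bar>)"
    if "set_pmf p \<subseteq> S" for p
    using that S by (simp add: D_def pmf_map_finite_support)
  have mem: "pmf p \<in> C" if "set_pmf p \<subseteq> S" for p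
    using that S by (auto simp: C_def T_def pmf_le_1 set_pmf_iff intro: sum_pmf_eq_1)
  have ex: "\<exists>p. pmf p = q \<and> set_pmf p \<subseteq> S" if "q \<in> C" for q
  proof -
    note q0 = C0[OF that]
    have "(\<integral>\<^sup>+x. ennreal (q x) \<partial>count_space UNIV) = (\<Sum>x\<in>S. ennreal (q x))"
      using S q0 by (intro nn_integral_count_space') auto
    also have "\<dots> = 1"
      using that q0 by (simp add: C_def)
    finally have pm: "pmf (embed_pmf q) = q"
      by (intro ext pmf_embed_pmf) (use q0 in auto)
    moreover have "set_pmf (embed_pmf q) \<subseteq> S"
      using q0(2) unfolding set_pmf_eq pm by blast
    ultimately show ?thesis by blast
  qed
  have Dpos: "D q > 0" if q: "q \<in> C'" for q
  proof -
    obtain p where p: "pmf p = q" "set_pmf p \<subseteq> S" using ex[of q] q by (auto simp: C'_def)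
    have "shannon_entropy p \<ge> m" using q p entC[OF p(2)] by (simp add: C'_def)
    then have "\<exists>i\<in>I. map_pmf (g i) p \<noteq> X" using less[OF p(2)] by force
    then obtain i where i: "i \<in> I" "map_pmf (g i) p \<noteq> X" by blast
    then obtain y where y: "pmf (map_pmf (g i) p) y \<noteq> pmf X y" by (metis pmf_eqI)
    have "set_pmf (map_pmf (g i) p) \<subseteq> Y" using Y(2)[OF i(1)] p(2) by auto
    \<comment> \<open>Outside \<open>Y\<close> both mass functions vanish, so a point where they
      differ is among those that \<open>D\<close> sums over.\<close>
    then have "y \<in> Y" using y Y(3) by (metis pmf_eq_0_set_pmf subsetD)
    then have "0 < (\<Sum>y\<in>Y. \<bar>pmf (map_pmf (g i) p) y - pmf X y\<bar>)"
      using y Y(1) by (intro sum_pos2[of _ y]) auto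
    then have "0 < D (pmf p)"
      unfolding DC[OF p(2)] using i I by (intro sum_pos2[of _ i]) (auto intro: sum_nonneg)
    then show ?thesis by (simp add: p)
  qed
  have contD: "continuous_on C' D"
    unfolding D_def by (intro continuous_on_sum continuous_on_rabs continuous_on_diff
        continuous_on_const coord)
  obtain \<delta> where \<delta>: "\<delta> > 0" "\<And>q. q \<in> C' \<Longrightarrow> D q \<ge> \<delta>"
  proof (cases "C' = {}")
    case True
    then show ?thesis using that[of 1] by simp
  next
    case False
    from continuous_attains_inf[OF \<open>compact C'\<close> this contD] Dpos show ?thesis
      using that by blast
  qed
  show ?thesis
  proof (rule that[OF \<delta>(1)])
    fix p assume p: "set_pmf p \<subseteq> S"
      "(\<Sum>i\<in>I. \<Sum>y\<in>Y. \<bar>pmf (map_pmf (g i) p) y - pmf X y\<bar>) < \<delta>"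
    then have "D (pmf p) < \<delta>" by (simp add: DC)
    then have "pmf p \<notin> C'" using \<delta>(2) by force
    then show "shannon_entropy p < m" using mem[OF p(1)] entC[OF p(1)] by (simp add: C'_def)
  qed
qed

section \<open>Positivity of mutual information\<close>

lemma sum_pmf_map:
  assumes "finite (set_pmf p)"
  shows "(\<Sum>y\<in>set_pmf (map_pmf f p). pmf (map_pmf f p) y * \<phi> y) = (\<Sum>x\<in>set_pmf p. pmf p x * \<phi> (f x))"
proof -
  have "(\<Sum>y\<in>set_pmf (map_pmf f p). pmf (map_pmf f p) y * \<phi> y)
      = (\<Sum>y\<in>f ` set_pmf p. \<Sum>x | x \<in> set_pmf p \<and> f x = y. pmf p x * \<phi> (f x))"
    by (intro sum.cong) (auto simp: pmf_map_finite_support[OF assms] sum_distrib_right)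
  also have "\<dots> = (\<Sum>x\<in>set_pmf p. pmf p x * \<phi> (f x))"
    using assms by (intro sum.group) auto
  finally show ?thesis .
qed

text \<open>The difference of the two sides is the relative entropy of \<open>X\<close> with respect
  to the product of its marginals. Gibbs' inequality makes it nonnegative, and its equality case
  would make \<open>X\<close> a product.\<close>

lemma shannon_entropy_less_marginals:
  assumes fin: "finite (set_pmf X)" and dep: "X \<noteq> pair_pmf (map_pmf fst X) (map_pmf snd X)"
  shows "shannon_entropy X < shannon_entropy (map_pmf fst X) + shannon_entropy (map_pmf snd X)"
proof -
  let ?P = "pair_pmf (map_pmf fst X) (map_pmf snd X)"
  have P: "pmf ?P x = pmf (map_pmf fst X) (fst x) * pmf (map_pmf snd X) (snd x)" for x
    by (cases x) (simp add: pmf_pair)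
  have pos: "pmf X x > 0" "pmf ?P x > 0"
    "pmf (map_pmf fst X) (fst x) > 0" "pmf (map_pmf snd X) (snd x) > 0" if "x \<in> set_pmf X" for x
  proof -
    show "pmf X x > 0" using that by (simp add: pmf_positive)
    show "pmf (map_pmf fst X) (fst x) > 0" using that by (intro pmf_positive) auto
    moreover show "pmf (map_pmf snd X) (snd x) > 0" using that by (intro pmf_positive) auto
    ultimately show "pmf ?P x > 0" by (simp add: P)
  qed
  have "shannon_entropy (map_pmf fst X) + shannon_entropy (map_pmf snd X) - shannon_entropy X
      = (\<Sum>x\<in>set_pmf X. pmf X x * (- ln (pmf ?P x / pmf X x)))"
    unfolding shannon_entropy_def sum_pmf_map[OF fin]
    unfolding sum_negf[symmetric] sum.distrib[symmetric] sum_subtractf[symmetric]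
  proof (intro sum.cong refl)
    fix x assume "x \<in> set_pmf X"
    from pos[OF this] show "- (pmf X x * ln (pmf (map_pmf fst X) (fst x)))
        + - (pmf X x * ln (pmf (map_pmf snd X) (snd x))) - - (pmf X x * ln (pmf X x))
        = pmf X x * (- ln (pmf ?P x / pmf X x))"
      by (simp add: ln_div ln_mult P algebra_simps)
  qed
  \<comment> \<open>Termwise this is \<open>- ln u \<ge> 1 - u\<close> for
    \<open>u = pmf ?P x / pmf X x\<close>, with equality only at \<open>u = 1\<close>. The smaller
    sum is 1 minus the mass that \<open>?P\<close> gives to the support of \<open>X\<close>, hence
    nonnegative.\<close>
  also have "\<dots> > (\<Sum>x\<in>set_pmf X. pmf X x - pmf ?P x)"
  proof (intro sum_strict_mono_ex1[OF fin])
    have le: "pmf X x - pmf ?P x \<le> pmf X x * (- ln (pmf ?P x / pmf X x))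
      \<and> (pmf X x - pmf ?P x = pmf X x * (- ln (pmf ?P x / pmf X x)) \<longrightarrow> pmf X x = pmf ?P x)"
      if "x \<in> set_pmf X" for x
    proof -
      let ?u = "pmf ?P x / pmf X x"
      have u: "?u > 0" "pmf ?P x = pmf X x * ?u" using pos[OF that] by auto
      have eq: "pmf X x - pmf ?P x = pmf X x * (1 - ?u)"
        using pos(1)[OF that] by (simp add: right_diff_distrib)
      have "pmf X x * (1 - ?u) \<le> pmf X x * (- ln ?u)"
        using ln_le_minus_one[OF u(1)] pos(1)[OF that] by (intro mult_left_mono) auto
      moreover have "?u = 1" if "pmf X x * (1 - ?u) = pmf X x * (- ln ?u)"
      proof -
        have "1 - ?u = - ln ?u"
          using that pos(1)[OF \<open>x \<in> set_pmf X\<close>] by (metis less_irrefl mult_left_cancel)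
        then show ?thesis using ln_eq_minus_one[OF u(1)] by linarith
      qed
      moreover have "pmf X x = pmf ?P x" if "?u = 1"
        using u(2) that by (metis mult.right_neutral)
      ultimately show ?thesis unfolding eq by blast
    qed
    then show "\<forall>x\<in>set_pmf X. pmf X x - pmf ?P x \<le> pmf X x * (- ln (pmf ?P x / pmf X x))"
      by blast
    show "\<exists>x\<in>set_pmf X. pmf X x - pmf ?P x < pmf X x * (- ln (pmf ?P x / pmf X x))"
    proof (rule ccontr)
      assume "\<not> ?thesis"
      then have eq: "pmf X x = pmf ?P x" if "x \<in> set_pmf X" for x
        using le[OF that] that by force
      \<comment> \<open>Agreement on the support of \<open>X\<close> already gives \<open>?P\<close>
        mass 1 there, so nothing is left outside and the two distributions coincide, against
        \<open>dep\<close>.\<close>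
      have "measure (measure_pmf ?P) (set_pmf X) = (\<Sum>x\<in>set_pmf X. pmf X x)"
        using fin eq by (simp add: measure_measure_pmf_finite)
      also have "\<dots> = 1" using fin by (intro sum_pmf_eq_1) auto
      finally have "AE x in measure_pmf ?P. x \<in> set_pmf X"
        by (subst measure_pmf.prob_eq_1[symmetric]) auto
      then have "set_pmf ?P \<subseteq> set_pmf X" by (auto simp: AE_measure_pmf_iff)
      then have "pmf X x = pmf ?P x" for x
        using eq by (cases "x \<in> set_pmf X") (metis pmf_eq_0_set_pmf subsetD)+
      then show False using dep by (metis pmf_eqI)
    qed
  qed
  also have "(\<Sum>x\<in>set_pmf X. pmf X x - pmf ?P x) = 1 - (\<Sum>x\<in>set_pmf X. pmf ?P x)"
    using sum_pmf_eq_1[OF fin order_refl] by (simp add: sum_subtractf)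
  finally have "1 - (\<Sum>x\<in>set_pmf X. pmf ?P x) < shannon_entropy (map_pmf fst X)
      + shannon_entropy (map_pmf snd X) - shannon_entropy X" .
  moreover have "(\<Sum>x\<in>set_pmf X. pmf ?P x) = measure (measure_pmf ?P) (set_pmf X)"
    using fin by (simp add: measure_measure_pmf_finite)
  moreover have "measure (measure_pmf ?P) (set_pmf X) \<le> 1" by simp
  ultimately show ?thesis by linarith
qed

section \<open>Type graphs\<close>

lemma permute_list_inverse:
  assumes "\<pi> permutes {..<length xs}"
  shows "permute_list (inv \<pi>) (permute_list \<pi> xs) = xs"
proof -
  have "permute_list (inv \<pi>) (permute_list \<pi> xs) = permute_list (\<pi> \<circ> inv \<pi>) xs"
    by (rule permute_list_compose[symmetric]) (rule permutes_inv[OF assms])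
  then show ?thesis by (simp add: permutes_inv_o(1)[OF assms])
qed

text \<open>Vertices must be natural numbers; \<open>c1\<close> and \<open>c2\<close> encode the sequences that serve as vertices.\<close>

locale type_graph =
  fixes F1 :: "'a set" and F2 :: "'b set" and c1 :: "'a list \<Rightarrow> nat" and c2 :: "'b list \<Rightarrow> nat"
  assumes finite_F: "finite F1" "finite F2"
    and inj_c1: "inj_on c1 (lists F1)" and inj_c2: "inj_on c2 (lists F2)"
    and disjoint: "c1 xs \<noteq> c2 ys"
begin

text \<open>Edges are parametrised by lists of pairs, so edge transitivity becomes the fact that two
  arrangements of one multiset differ by a permutation of positions.\<close>

definition graph :: "('a \<times> 'b) multiset \<Rightarrow> nat bigraph" where
  "graph A = \<lparr>part1 = c1 ` permutations_of_multiset (image_mset fst A),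
    part2 = c2 ` permutations_of_multiset (image_mset snd A),
    edges = (\<lambda>L. (c1 (map fst L), c2 (map snd L))) ` permutations_of_multiset A\<rparr>"

context
  fixes A :: "('a \<times> 'b) multiset"
  assumes A: "set_mset A \<subseteq> F1 \<times> F2"
begin

lemma perms_lists:
  shows "permutations_of_multiset (image_mset fst A) \<subseteq> lists F1"
    and "permutations_of_multiset (image_mset snd A) \<subseteq> lists F2"
    and "permutations_of_multiset A \<subseteq> lists (F1 \<times> F2)"
proof -
  have "fst ` set_mset A \<subseteq> F1" "snd ` set_mset A \<subseteq> F2" using A by auto
  then show "permutations_of_multiset (image_mset fst A) \<subseteq> lists F1"
    "permutations_of_multiset (image_mset snd A) \<subseteq> lists F2"
    "permutations_of_multiset A \<subseteq> lists (F1 \<times> F2)"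
    using A by (auto intro!: order_trans[OF permutations_of_multiset_lists] lists_mono
        simp del: in_lists_conv_set)
qed

lemma c1_eq_iff: "xs \<in> lists F1 \<Longrightarrow> xs' \<in> lists F1 \<Longrightarrow> c1 xs = c1 xs' \<longleftrightarrow> xs = xs'"
  using inj_c1 by (auto dest: inj_onD)

lemma c2_eq_iff: "ys \<in> lists F2 \<Longrightarrow> ys' \<in> lists F2 \<Longrightarrow> c2 ys = c2 ys' \<longleftrightarrow> ys = ys'"
  using inj_c2 by (auto dest: inj_onD)

lemma c1_in_part1_iff: "xs \<in> lists F1 \<Longrightarrow> c1 xs \<in> part1 (graph A) \<longleftrightarrow> mset xs = image_mset fst A"
  by (simp add: graph_def inj_on_image_mem_iff[OF inj_c1 _ perms_lists(1)])
    (simp add: permutations_of_multiset_def)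

lemma c2_in_part2_iff: "ys \<in> lists F2 \<Longrightarrow> c2 ys \<in> part2 (graph A) \<longleftrightarrow> mset ys = image_mset snd A"
  by (simp add: graph_def inj_on_image_mem_iff[OF inj_c2 _ perms_lists(2)])
    (simp add: permutations_of_multiset_def)

lemma part_disjoint: "c2 ys \<notin> part1 (graph A)" "c1 xs \<notin> part2 (graph A)"
  using disjoint by (auto simp: graph_def) metis+

lemma edge_iff:
  assumes "xs \<in> lists F1" "ys \<in> lists F2" "length xs = length ys"
  shows "(c1 xs, c2 ys) \<in> edges (graph A) \<longleftrightarrow> mset (zip xs ys) = A"
proof
  assume "(c1 xs, c2 ys) \<in> edges (graph A)"
  then obtain L where L: "L \<in> permutations_of_multiset A" "c1 xs = c1 (map fst L)" "c2 ys = c2 (map snd L)"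
    by (auto simp: graph_def)
  have "L \<in> lists (F1 \<times> F2)" using L(1) perms_lists(3) by blast
  then have "map fst L \<in> lists F1" "map snd L \<in> lists F2"
    unfolding lists_eq_set by fastforce+
  then have "xs = map fst L" "ys = map snd L" using L assms c1_eq_iff c2_eq_iff by auto
  then have "zip xs ys = L" by (simp add: zip_map_fst_snd)
  then show "mset (zip xs ys) = A" using L(1) by (simp add: permutations_of_multisetD)
next
  assume "mset (zip xs ys) = A"
  then have "zip xs ys \<in> permutations_of_multiset A" by (rule permutations_of_multisetI)
  moreover have "xs = map fst (zip xs ys)" "ys = map snd (zip xs ys)" using assms by auto
  ultimately show "(c1 xs, c2 ys) \<in> edges (graph A)"
    unfolding graph_def by (simp only: bigraph.simps) (metis (mono_tags, lifting) image_eqI)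
qed

lemma bipartite_graph: "bipartite_graph (graph A)"
  unfolding bipartite_graph_def
proof (intro conjI)
  show "part1 (graph A) \<inter> part2 (graph A) = {}"
    using disjoint by (auto simp: graph_def)
  show "edges (graph A) \<subseteq> part1 (graph A) \<times> part2 (graph A)"
    by (auto simp: graph_def permutations_of_multiset_image)
qed (auto simp: graph_def)

lemma edges_nonempty: "edges (graph A) \<noteq> {}"
  by (simp add: graph_def)

lemma card_parts:
  "card (part1 (graph A)) = card (permutations_of_multiset (image_mset fst A))"
  "card (part2 (graph A)) = card (permutations_of_multiset (image_mset snd A))"
  unfolding graph_def
  using inj_on_subset[OF inj_c1 perms_lists(1)] inj_on_subset[OF inj_c2 perms_lists(2)]
  by (simp_all add: card_image)

text \<open>Permuting positions changes neither the type of a sequence nor, since it commutes with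
  \<open>zip\<close>, the joint type of two sequences. So vertices go to vertices of the same class,
  and adjacency is preserved in both directions.\<close>

lemma automorphism_of_permutation:
  assumes \<pi>: "\<pi> permutes {..<size A}"
  shows "\<exists>\<phi>\<in>Aut (graph A). (\<forall>xs. c1 xs \<in> part1 (graph A) \<longrightarrow> xs \<in> lists F1 \<longrightarrow> \<phi> (c1 xs) = c1 (permute_list \<pi> xs))
    \<and> (\<forall>ys. c2 ys \<in> part2 (graph A) \<longrightarrow> ys \<in> lists F2 \<longrightarrow> \<phi> (c2 ys) = c2 (permute_list \<pi> ys))"
proof -
  let ?G = "graph A"
  \<comment> \<open>Decode, permute, encode again. Decoding is well defined because the codes are
    injective on lists over \<open>F1\<close> and \<open>F2\<close>, and the test for
    \<open>part1 ?G\<close> separates the classes because no code of one kind equals a code of the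
    other.\<close>
  define \<phi> where "\<phi> = (\<lambda>x\<in>verts ?G. if x \<in> part1 ?G
    then c1 (permute_list \<pi> (the_inv_into (lists F1) c1 x))
    else c2 (permute_list \<pi> (the_inv_into (lists F2) c2 x)))"
  have \<phi>1: "\<phi> (c1 xs) = c1 (permute_list \<pi> xs)" if "c1 xs \<in> part1 ?G" "xs \<in> lists F1" for xs
    using that by (simp add: \<phi>_def verts_def the_inv_into_f_f[OF inj_c1])
  have \<phi>2: "\<phi> (c2 ys) = c2 (permute_list \<pi> ys)" if "c2 ys \<in> part2 ?G" "ys \<in> lists F2" for ys
    using that part_disjoint by (simp add: \<phi>_def verts_def the_inv_into_f_f[OF inj_c2])
  have len1: "length xs = size A" if "xs \<in> permutations_of_multiset (image_mset fst A)" for xs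
    using length_finite_permutations_of_multiset[OF that] by simp
  have len2: "length ys = size A" if "ys \<in> permutations_of_multiset (image_mset snd A)" for ys
    using length_finite_permutations_of_multiset[OF that] by simp
  have lists: "permute_list \<pi> zs \<in> lists T" if "zs \<in> lists T" "length zs = size A"
    for zs :: "'c list" and T
    using that \<pi> set_permute_list[of \<pi> zs] by (simp add: lists_eq_set)
  have cancel: "zs = zs'" if "permute_list \<pi> zs = permute_list \<pi> zs'"
    "length zs = size A" "length zs' = size A" for zs zs' :: "'c list"
    using that \<pi> by (metis permute_list_inverse)
  have P1: "\<exists>xs. x = c1 xs \<and> xs \<in> permutations_of_multiset (image_mset fst A) \<and> xs \<in> lists F1"
    if "x \<in> part1 ?G" for x
    using that perms_lists(1) by (auto simp: graph_def)
  have P2: "\<exists>ys. y = c2 ys \<and> ys \<in> permutations_of_multiset (image_mset snd A) \<and> ys \<in> lists F2"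
    if "y \<in> part2 ?G" for y
    using that perms_lists(2) by (auto simp: graph_def)
  have mset_perm: "mset (permute_list \<pi> zs) = mset zs" if "length zs = size A" for zs :: "'c list"
    using that \<pi> by simp
  have "\<phi> ` part1 ?G \<subseteq> part1 ?G"
  proof
    fix z assume "z \<in> \<phi> ` part1 ?G"
    then obtain x where x: "x \<in> part1 ?G" "z = \<phi> x" by blast
    then obtain xs where xs: "x = c1 xs" "xs \<in> permutations_of_multiset (image_mset fst A)" "xs \<in> lists F1"
      using P1 by blast
    then show "z \<in> part1 ?G"
      using x \<phi>1 c1_in_part1_iff lists[OF xs(3) len1[OF xs(2)]] mset_perm[OF len1[OF xs(2)]]
      by (simp add: permutations_of_multisetD)
  qed
  moreover have "inj_on \<phi> (part1 ?G)"
  proof (rule inj_onI)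
    fix x x' assume *: "x \<in> part1 ?G" "x' \<in> part1 ?G" "\<phi> x = \<phi> x'"
    obtain xs xs' where xs: "x = c1 xs" "xs \<in> permutations_of_multiset (image_mset fst A)" "xs \<in> lists F1"
      "x' = c1 xs'" "xs' \<in> permutations_of_multiset (image_mset fst A)" "xs' \<in> lists F1"
      using P1[OF *(1)] P1[OF *(2)] by blast
    then show "x = x'"
      using * \<phi>1 c1_eq_iff lists len1 cancel[of xs xs'] by metis
  qed
  ultimately have b1: "bij_betw \<phi> (part1 ?G) (part1 ?G)"
    using bipartite_graph unfolding bipartite_graph_def by (simp add: bij_betw_def endo_inj_surj)
  have "\<phi> ` part2 ?G \<subseteq> part2 ?G"
  proof
    fix z assume "z \<in> \<phi> ` part2 ?G"
    then obtain y where y: "y \<in> part2 ?G" "z = \<phi> y" by blast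
    then obtain ys where ys: "y = c2 ys" "ys \<in> permutations_of_multiset (image_mset snd A)" "ys \<in> lists F2"
      using P2 by blast
    then show "z \<in> part2 ?G"
      using y \<phi>2 c2_in_part2_iff lists[OF ys(3) len2[OF ys(2)]] mset_perm[OF len2[OF ys(2)]]
      by (simp add: permutations_of_multisetD)
  qed
  moreover have "inj_on \<phi> (part2 ?G)"
  proof (rule inj_onI)
    fix y y' assume *: "y \<in> part2 ?G" "y' \<in> part2 ?G" "\<phi> y = \<phi> y'"
    obtain ys ys' where ys: "y = c2 ys" "ys \<in> permutations_of_multiset (image_mset snd A)" "ys \<in> lists F2"
      "y' = c2 ys'" "ys' \<in> permutations_of_multiset (image_mset snd A)" "ys' \<in> lists F2"
      using P2[OF *(1)] P2[OF *(2)] by blast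
    then show "y = y'"
      using * \<phi>2 c2_eq_iff lists len2 cancel[of ys ys'] by metis
  qed
  ultimately have b2: "bij_betw \<phi> (part2 ?G) (part2 ?G)"
    using bipartite_graph unfolding bipartite_graph_def by (simp add: bij_betw_def endo_inj_surj)
  have e: "(\<phi> x, \<phi> y) \<in> edges ?G \<longleftrightarrow> (x, y) \<in> edges ?G" if xy: "x \<in> part1 ?G" "y \<in> part2 ?G" for x y
  proof -
    obtain xs ys where xs: "x = c1 xs" "xs \<in> permutations_of_multiset (image_mset fst A)" "xs \<in> lists F1"
      and ys: "y = c2 ys" "ys \<in> permutations_of_multiset (image_mset snd A)" "ys \<in> lists F2"
      using P1[OF xy(1)] P2[OF xy(2)] by blast
    note len = len1[OF xs(2)] len2[OF ys(2)]
    have "zip (permute_list \<pi> xs) (permute_list \<pi> ys) = permute_list \<pi> (zip xs ys)"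
      using len \<pi> by (intro permute_list_zip[symmetric]) auto
    then have "mset (zip (permute_list \<pi> xs) (permute_list \<pi> ys)) = mset (zip xs ys)"
      using len \<pi> by simp
    then show ?thesis
      using xy \<phi>1[of xs] \<phi>2[of ys] xs ys len lists[OF xs(3) len(1)] lists[OF ys(3) len(2)]
      by (simp add: edge_iff)
  qed
  have "\<phi> \<in> Aut ?G"
    unfolding Aut_def using b1 b2 e by (auto simp: \<phi>_def)
  then show ?thesis using \<phi>1 \<phi>2 by blast
qed

lemma edge_vertex_transitive: "edge_vertex_transitive (graph A)"
proof -
  let ?G = "graph A"
  have E: "\<exists>\<phi>\<in>Aut ?G. \<phi> v = v' \<and> \<phi> w = w'" if e: "(v, w) \<in> edges ?G" "(v', w') \<in> edges ?G" for v w v' w'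
  proof -
    obtain L where L: "L \<in> permutations_of_multiset A" "v = c1 (map fst L)" "w = c2 (map snd L)"
      using e(1) unfolding graph_def by auto
    obtain L' where L': "L' \<in> permutations_of_multiset A" "v' = c1 (map fst L')" "w' = c2 (map snd L')"
      using e(2) unfolding graph_def by auto
    then have "mset L' = mset L" using L(1) by (simp add: permutations_of_multisetD)
    then obtain \<pi> where \<pi>: "\<pi> permutes {..<length L}" "permute_list \<pi> L = L'"
      by (rule mset_eq_permutation)
    have "length L = size A" using L(1) by (rule length_finite_permutations_of_multiset)
    then obtain \<phi> where \<phi>: "\<phi> \<in> Aut ?G"
      "\<And>xs. c1 xs \<in> part1 ?G \<Longrightarrow> xs \<in> lists F1 \<Longrightarrow> \<phi> (c1 xs) = c1 (permute_list \<pi> xs)"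
      "\<And>ys. c2 ys \<in> part2 ?G \<Longrightarrow> ys \<in> lists F2 \<Longrightarrow> \<phi> (c2 ys) = c2 (permute_list \<pi> ys)"
      using automorphism_of_permutation[of \<pi>] \<pi>(1) by metis
    have "L \<in> lists (F1 \<times> F2)" using L(1) perms_lists(3) by blast
    then have "map fst L \<in> lists F1" "map snd L \<in> lists F2"
    unfolding lists_eq_set by fastforce+
    moreover have "c1 (map fst L) \<in> part1 ?G" "c2 (map snd L) \<in> part2 ?G"
      using e(1) L bipartite_graph unfolding bipartite_graph_def by blast+
    ultimately have "\<phi> v = v'" "\<phi> w = w'"
      using \<phi>(2,3) \<pi> L L' by (simp_all add: permute_list_map)
    then show ?thesis using \<phi>(1) by blast
  qed
  \<comment> \<open>Every sequence with the right marginal type extends to a list of pairs of type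
    \<open>A\<close>. So every vertex lies on an edge, and vertex transitivity follows from edge
    transitivity.\<close>
  have "\<exists>w. (v, w) \<in> edges ?G" if "v \<in> part1 ?G" for v
    using that by (auto simp: graph_def permutations_of_multiset_image)
  moreover have "\<exists>v. (v, w) \<in> edges ?G" if "w \<in> part2 ?G" for w
    using that by (auto simp: graph_def permutations_of_multiset_image)
  ultimately have V: "\<exists>\<phi>\<in>Aut ?G. \<phi> v = v'" if "v \<in> part1 ?G \<and> v' \<in> part1 ?G \<or> v \<in> part2 ?G \<and> v' \<in> part2 ?G" for v v'
    using that E by metis
  show ?thesis
    unfolding edge_vertex_transitive_def
  proof (intro conjI ballI)
    fix e assume "e \<in> edges ?G"
    then show "case e of (v, w) \<Rightarrow> \<forall>(v', w')\<in>edges ?G. \<exists>\<phi>\<in>Aut ?G. \<phi> v = v' \<and> \<phi> w = w'"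
      using E by (cases e) blast
  qed (use V in blast)+
qed

end

end

section \<open>Homomorphisms into type graphs\<close>

definition marginal :: "'v \<times> 'v \<Rightarrow> ('v \<Rightarrow> 'a) \<times> ('v \<Rightarrow> 'b) \<Rightarrow> 'a \<times> 'b" where
  "marginal e s = (fst s (fst e), snd s (snd e))"

lemma Q_altdef:
  "Q F1 F2 H X = {p. set_pmf p \<subseteq> (part1 H \<rightarrow>\<^sub>E F1) \<times> (part2 H \<rightarrow>\<^sub>E F2) \<and>
     (\<forall>e\<in>edges H. map_pmf (marginal e) p = X)}"
  unfolding Q_def marginal_def case_prod_unfold ..

context type_graph
begin

definition labellings :: "'v bigraph \<Rightarrow> (('v \<Rightarrow> 'a) \<times> ('v \<Rightarrow> 'b)) set" where
  "labellings H = (part1 H \<rightarrow>\<^sub>E F1) \<times> (part2 H \<rightarrow>\<^sub>E F2)"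

lemma finite_labellings: "bipartite_graph H \<Longrightarrow> finite (labellings H)"
  using finite_F by (simp add: labellings_def bipartite_graph_def finite_PiE)

text \<open>A homomorphism from \<open>H\<close> to \<open>graph A\<close> is a sequence of labellings of \<open>H\<close>, read column by column;
  these are the types of such sequences.\<close>

definition hom_types :: "'v bigraph \<Rightarrow> ('a \<times> 'b) multiset \<Rightarrow> (('v \<Rightarrow> 'a) \<times> ('v \<Rightarrow> 'b)) multiset set" where
  "hom_types H A = {R. set_mset R \<subseteq> labellings H \<and> size R = size A \<and>
     (\<forall>e\<in>edges H. image_mset (marginal e) R = A)}"

definition hom_of_list :: "'v bigraph \<Rightarrow> (('v \<Rightarrow> 'a) \<times> ('v \<Rightarrow> 'b)) list \<Rightarrow> 'v \<Rightarrow> nat" where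
  "hom_of_list H L = (\<lambda>x\<in>verts H. if x \<in> part1 H then c1 (map (\<lambda>s. fst s x) L)
     else c2 (map (\<lambda>s. snd s x) L))"

text \<open>Transposition of an array: its columns are labellings of \<open>H\<close>, its rows are
  the sequences assigned to the vertices. The joint type of two rows is the marginal at these two
  vertices of the type of the column list, so the edge conditions on both sides agree.\<close>

lemma bij_betw_hom_of_list:
  assumes H: "bipartite_graph H" "no_isolated H" and A: "set_mset A \<subseteq> F1 \<times> F2"
  shows "bij_betw (hom_of_list H) {L. mset L \<in> hom_types H A} (Hom H (graph A))"
proof (rule bij_betw_imageI)
  let ?\<Phi> = "hom_of_list H" and ?G = "graph A"
  have EH: "v \<in> part1 H" "w \<in> part2 H" if "(v, w) \<in> edges H" for v w
    using that H(1) by (auto simp: bipartite_graph_def)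
  have dj: "v \<notin> part1 H" if "v \<in> part2 H" for v
    using that H(1) by (auto simp: bipartite_graph_def)
  have \<Phi>1: "?\<Phi> L v = c1 (map (\<lambda>s. fst s v) L)" if "v \<in> part1 H" for L v
    using that by (simp add: hom_of_list_def verts_def)
  have \<Phi>2: "?\<Phi> L v = c2 (map (\<lambda>s. snd s v) L)" if "v \<in> part2 H" for L v
    using that dj[OF that] by (simp add: hom_of_list_def verts_def)
  have lists1: "map (\<lambda>s. fst s v) L \<in> lists F1" if "v \<in> part1 H" "set L \<subseteq> labellings H" for L v
    using that by (fastforce simp: labellings_def)
  have lists2: "map (\<lambda>s. snd s v) L \<in> lists F2" if "v \<in> part2 H" "set L \<subseteq> labellings H" for L v
    using that by (fastforce simp: labellings_def)
  have zip: "mset (zip (map (\<lambda>s. fst s v) L) (map (\<lambda>s. snd s w) L)) = image_mset (marginal (v, w)) (mset L)"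
    for L v w
    by (simp add: zip_map_map marginal_def[abs_def] zip_same_conv_map case_prod_unfold comp_def
        flip: mset_map)
  show "inj_on ?\<Phi> {L. mset L \<in> hom_types H A}"
  proof (rule inj_onI)
    fix L L' assume L: "L \<in> {L. mset L \<in> hom_types H A}" "L' \<in> {L. mset L \<in> hom_types H A}"
      and eq: "?\<Phi> L = ?\<Phi> L'"
    have sets: "set L \<subseteq> labellings H" "set L' \<subseteq> labellings H"
      and len: "length L = size A" "length L' = size A"
      using L by (auto simp: hom_types_def simp flip: size_mset)
    show "L = L'"
    proof (rule nth_equalityI)
      show "length L = length L'" using len by simp
      fix t assume t: "t < length L"
      then have t': "t < length L'" using len by simp
      have 1: "fst (L ! t) v = fst (L' ! t) v" if v: "v \<in> part1 H" for v
      proof -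
        have "map (\<lambda>s. fst s v) L = map (\<lambda>s. fst s v) L'"
          using fun_cong[OF eq, of v] \<Phi>1[OF v] lists1[OF v sets(1)] lists1[OF v sets(2)] c1_eq_iff[OF A]
          by simp
        then have "map (\<lambda>s. fst s v) L ! t = map (\<lambda>s. fst s v) L' ! t" by simp
        then show ?thesis using t t' by simp
      qed
      have 2: "snd (L ! t) v = snd (L' ! t) v" if v: "v \<in> part2 H" for v
      proof -
        have "map (\<lambda>s. snd s v) L = map (\<lambda>s. snd s v) L'"
          using fun_cong[OF eq, of v] \<Phi>2[OF v] lists2[OF v sets(1)] lists2[OF v sets(2)] c2_eq_iff[OF A]
          by simp
        then have "map (\<lambda>s. snd s v) L ! t = map (\<lambda>s. snd s v) L' ! t" by simp
        then show ?thesis using t t' by simp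
      qed
      have "L ! t \<in> labellings H" "L' ! t \<in> labellings H"
        using sets t t' by (meson nth_mem subsetD)+
      then have mem: "fst (L ! t) \<in> part1 H \<rightarrow>\<^sub>E F1" "fst (L' ! t) \<in> part1 H \<rightarrow>\<^sub>E F1"
          "snd (L ! t) \<in> part2 H \<rightarrow>\<^sub>E F2" "snd (L' ! t) \<in> part2 H \<rightarrow>\<^sub>E F2"
        by (auto simp: labellings_def mem_Times_iff)
      have "fst (L ! t) = fst (L' ! t)" using mem(1,2) 1 by (rule PiE_ext)
      moreover have "snd (L ! t) = snd (L' ! t)" using mem(3,4) 2 by (rule PiE_ext)
      ultimately show "L ! t = L' ! t" by (rule prod_eqI)
    qed
  qed
  show "?\<Phi> ` {L. mset L \<in> hom_types H A} = Hom H ?G"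
  proof (intro equalityI subsetI)
    fix \<phi> assume "\<phi> \<in> ?\<Phi> ` {L. mset L \<in> hom_types H A}"
    then obtain L where L: "mset L \<in> hom_types H A" "\<phi> = ?\<Phi> L" by auto
    have sets: "set L \<subseteq> labellings H" using L by (auto simp: hom_types_def)
    have E: "(\<phi> v, \<phi> w) \<in> edges ?G" if e: "(v, w) \<in> edges H" for v w
      unfolding L(2) \<Phi>1[OF EH(1)[OF e]] \<Phi>2[OF EH(2)[OF e]]
      using lists1[OF EH(1)[OF e] sets] lists2[OF EH(2)[OF e] sets] L(1) e
      by (subst edge_iff[OF A]) (auto simp: zip hom_types_def simp del: mset_map)
    \<comment> \<open>The type of a row is inherited from an edge at its vertex; this is where
      \<open>no_isolated\<close> enters.\<close>
    have "\<phi> v \<in> part1 ?G" if "v \<in> part1 H" for v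
      using that H(2) E bipartite_graph[OF A] unfolding no_isolated_def bipartite_graph_def by blast
    moreover have "\<phi> w \<in> part2 ?G" if "w \<in> part2 H" for w
      using that H(2) E bipartite_graph[OF A] unfolding no_isolated_def bipartite_graph_def by blast
    moreover have "\<phi> \<in> extensional (verts H)" by (simp add: L(2) hom_of_list_def)
    ultimately show "\<phi> \<in> Hom H ?G" using E
      by (auto simp: Hom_def PiE_def verts_def)
  next
    fix \<phi> assume \<phi>: "\<phi> \<in> Hom H ?G"
    have \<phi>1: "\<exists>xs. \<phi> v = c1 xs \<and> xs \<in> permutations_of_multiset (image_mset fst A)" if "v \<in> part1 H" for v
      using that \<phi> by (auto simp: Hom_def graph_def)
    have \<phi>2: "\<exists>ys. \<phi> w = c2 ys \<and> ys \<in> permutations_of_multiset (image_mset snd A)" if "w \<in> part2 H" for w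
      using that \<phi> by (auto simp: Hom_def graph_def)
    obtain f where f: "\<And>v. v \<in> part1 H \<Longrightarrow> \<phi> v = c1 (f v)"
      "\<And>v. v \<in> part1 H \<Longrightarrow> f v \<in> permutations_of_multiset (image_mset fst A)"
      using \<phi>1 by metis
    obtain g where g: "\<And>w. w \<in> part2 H \<Longrightarrow> \<phi> w = c2 (g w)"
      "\<And>w. w \<in> part2 H \<Longrightarrow> g w \<in> permutations_of_multiset (image_mset snd A)"
      using \<phi>2 by metis
    \<comment> \<open>The \<open>t\<close>-th column collects the \<open>t\<close>-th entries of all
      the decoded vertex sequences.\<close>
    define L where "L = map (\<lambda>t. (\<lambda>v\<in>part1 H. f v ! t, \<lambda>w\<in>part2 H. g w ! t)) [0..<size A]"
    have lenf: "length (f v) = size A" "f v \<in> lists F1" if "v \<in> part1 H" for v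
      using f(2)[OF that] length_finite_permutations_of_multiset perms_lists(1)[OF A] by fastforce+
    have leng: "length (g v) = size A" "g v \<in> lists F2" if "v \<in> part2 H" for v
      using g(2)[OF that] length_finite_permutations_of_multiset perms_lists(2)[OF A] by fastforce+
    have Lf: "map (\<lambda>s. fst s v) L = f v" if "v \<in> part1 H" for v
      using that lenf(1)[OF that] by (intro nth_equalityI) (auto simp: L_def)
    have Lg: "map (\<lambda>s. snd s v) L = g v" if "v \<in> part2 H" for v
      using that leng(1)[OF that] by (intro nth_equalityI) (auto simp: L_def)
    have "f v ! t \<in> F1" if "v \<in> part1 H" "t < size A" for v t
      using lenf[OF that(1)] that(2) by (metis in_lists_conv_set nth_mem)
    moreover have "g v ! t \<in> F2" if "v \<in> part2 H" "t < size A" for v t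
      using leng[OF that(1)] that(2) by (metis in_lists_conv_set nth_mem)
    ultimately have "set L \<subseteq> labellings H"
      unfolding L_def labellings_def by auto
    moreover have "image_mset (marginal e) (mset L) = A" if e: "e \<in> edges H" for e
    proof -
      obtain v w where e': "e = (v, w)" by (cases e)
      note vw = EH[OF e[unfolded e']]
      have "(\<phi> v, \<phi> w) \<in> edges ?G" using \<phi> e e' by (auto simp: Hom_def)
      then have "mset (zip (f v) (g w)) = A"
        using f g vw lenf leng by (simp add: edge_iff[OF A])
      then show ?thesis using zip[of v L w] Lf[OF vw(1)] Lg[OF vw(2)] e' by simp
    qed
    ultimately have "mset L \<in> hom_types H A"
      by (simp add: hom_types_def L_def)
    moreover have "\<phi> = ?\<Phi> L"
    proof
      fix x show "\<phi> x = ?\<Phi> L x"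
      proof (cases "x \<in> verts H")
        case True
        then show ?thesis using Lf Lg f(1) g(1) \<Phi>1 \<Phi>2 by (auto simp: verts_def)
      next
        case False
        then show ?thesis using \<phi> by (auto simp: hom_of_list_def Hom_def)
      qed
    qed
    ultimately show "\<phi> \<in> ?\<Phi> ` {L. mset L \<in> hom_types H A}" by blast
  qed
qed

lemma finite_hom_types:
  assumes "bipartite_graph H"
  shows "finite (hom_types H A)" "card (hom_types H A) \<le> (size A + 1) ^ card (labellings H)"
proof -
  have sub: "hom_types H A \<subseteq> {R. set_mset R \<subseteq> labellings H \<and> size R = size A}"
    by (auto simp: hom_types_def)
  note fin = finite_multisets_size[OF finite_labellings[OF assms], of "size A"]
  show "finite (hom_types H A)" using sub fin(1) by (rule finite_subset)
  show "card (hom_types H A) \<le> (size A + 1) ^ card (labellings H)"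
    using card_mono[OF fin(1) sub] fin(2) by linarith
qed

lemma card_Hom:
  assumes "bipartite_graph H" "no_isolated H" "set_mset A \<subseteq> F1 \<times> F2"
  shows "card (Hom H (graph A)) = (\<Sum>R\<in>hom_types H A. card (permutations_of_multiset R))"
proof -
  have "card (Hom H (graph A)) = card {L. mset L \<in> hom_types H A}"
    using bij_betw_same_card[OF bij_betw_hom_of_list[OF assms]] by simp
  also have "{L. mset L \<in> hom_types H A} = (\<Union>R\<in>hom_types H A. permutations_of_multiset R)"
    by (auto simp: permutations_of_multiset_def)
  also have "card \<dots> = (\<Sum>R\<in>hom_types H A. card (permutations_of_multiset R))"
    using finite_hom_types(1)[OF assms(1)]
    by (intro card_UN_disjoint) (auto dest: permutations_of_multisetD)
  finally show ?thesis .
qed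

lemma card_Hom_ge:
  assumes "bipartite_graph H" "no_isolated H" "set_mset A \<subseteq> F1 \<times> F2" "R \<in> hom_types H A"
  shows "card (permutations_of_multiset R) \<le> card (Hom H (graph A))"
  unfolding card_Hom[OF assms(1-3)]
  using finite_hom_types(1)[OF assms(1)] assms(4) by (intro member_le_sum) auto

text \<open>Homomorphisms split into classes by type. There are only polynomially many types, so up
  to this factor the largest class accounts for all homomorphisms.\<close>

lemma card_Hom_le:
  assumes H: "bipartite_graph H" "no_isolated H" and A: "set_mset A \<subseteq> F1 \<times> F2"
    and ne: "hom_types H A \<noteq> {}"
  obtains R where "R \<in> hom_types H A"
    "card (Hom H (graph A)) \<le> (size A + 1) ^ card (labellings H) * card (permutations_of_multiset R)"
proof -
  let ?P = "\<lambda>R. card (permutations_of_multiset R)"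
  have fin: "finite (?P ` hom_types H A)" using finite_hom_types(1)[OF H(1)] by simp
  have "Max (?P ` hom_types H A) \<in> ?P ` hom_types H A" using Max_in[OF fin] ne by blast
  then obtain R where R: "Max (?P ` hom_types H A) = ?P R" "R \<in> hom_types H A" by (rule imageE)
  have "card (Hom H (graph A)) \<le> card (hom_types H A) * ?P R"
    unfolding card_Hom[OF H A] using fin R(1)[symmetric] sum_bounded_above[of "hom_types H A" ?P "?P R"] by simp
  also have "\<dots> \<le> (size A + 1) ^ card (labellings H) * ?P R"
    using finite_hom_types(2)[OF H(1)] by (rule mult_right_mono) simp
  finally show ?thesis using that R(2) by blast
qed

end

section \<open>Removing isolated vertices\<close>

definition edge_core :: "'v bigraph \<Rightarrow> 'v bigraph" where
  "edge_core H = \<lparr>part1 = fst ` edges H, part2 = snd ` edges H, edges = edges H\<rparr>"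

lemma edge_core_in_\<B>\<^sub>0: "H \<in> \<B>\<^sub>0 \<Longrightarrow> edge_core H \<in> \<B>\<^sub>0"
proof -
  assume "H \<in> \<B>\<^sub>0"
  then have H: "bipartite_graph H" "edges H \<noteq> {}" by (auto simp: \<B>\<^sub>0_def \<B>_def)
  then have sub: "fst ` edges H \<subseteq> part1 H" "snd ` edges H \<subseteq> part2 H"
    by (auto simp: bipartite_graph_def)
  moreover have "edges H \<subseteq> fst ` edges H \<times> snd ` edges H" by force
  ultimately show ?thesis
    using H finite_subset[OF sub(1)] finite_subset[OF sub(2)]
    by (simp add: \<B>\<^sub>0_def \<B>_def edge_core_def bipartite_graph_def) blast
qed

lemma no_isolated_edge_core: "no_isolated (edge_core H)"
  unfolding no_isolated_def edge_core_def by auto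

text \<open>An isolated vertex may go anywhere in its class of \<open>G\<close>, and the resulting
  factor is cancelled by the normalisation. This extends convergence from graphs without isolated
  vertices to all of \<open>\<B>\<^sub>0\<close>, as log-convergence demands.\<close>

lemma hom_density_edge_core:
  assumes H: "bipartite_graph H" and G: "bipartite_graph G" "part1 G \<noteq> {}" "part2 G \<noteq> {}"
  shows "hom_density H G = hom_density (edge_core H) G"
proof -
  let ?C = "edge_core H"
  define I1 I2 where "I1 = part1 H - part1 ?C" and "I2 = part2 H - part2 ?C"
  have fin: "finite (part1 H)" "finite (part2 H)" "finite (part1 G)" "finite (part2 G)"
    and dj: "part1 H \<inter> part2 H = {}"
    using H G by (auto simp: bipartite_graph_def)
  have sub: "part1 ?C \<subseteq> part1 H" "part2 ?C \<subseteq> part2 H"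
    using H by (auto simp: bipartite_graph_def edge_core_def)
  have edges: "edges ?C = edges H" by (simp add: edge_core_def)
  have eV: "v \<in> part1 ?C" "w \<in> part2 ?C" if "(v, w) \<in> edges H" for v w
    using that by (force simp: edge_core_def)+
  \<comment> \<open>\<open>?f\<close> cuts a homomorphism into its core part and the free images of
    the isolated vertices in each class; \<open>?g\<close> glues such pieces together.\<close>
  let ?f = "\<lambda>\<phi>. (restrict \<phi> (verts ?C), restrict \<phi> I1, restrict \<phi> I2)"
  let ?g = "\<lambda>(a, b, c). \<lambda>x\<in>verts H. if x \<in> verts ?C then a x else if x \<in> I1 then b x else c x"
  have V: "verts H = verts ?C \<union> I1 \<union> I2" using sub by (auto simp: verts_def I1_def I2_def)
  have "bij_betw ?f (Hom H G) (Hom ?C G \<times> (I1 \<rightarrow>\<^sub>E part1 G) \<times> (I2 \<rightarrow>\<^sub>E part2 G))"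
  proof (rule bij_betw_byWitness[where f' = ?g])
    show "\<forall>\<phi>\<in>Hom H G. ?g (?f \<phi>) = \<phi>"
      using V by (auto simp: Hom_def PiE_def extensional_def fun_eq_iff)
    show "\<forall>y\<in>Hom ?C G \<times> (I1 \<rightarrow>\<^sub>E part1 G) \<times> (I2 \<rightarrow>\<^sub>E part2 G). ?f (?g y) = y"
    proof
      fix y assume "y \<in> Hom ?C G \<times> (I1 \<rightarrow>\<^sub>E part1 G) \<times> (I2 \<rightarrow>\<^sub>E part2 G)"
      then obtain a b c where y: "y = (a, b, c)"
        and a: "a \<in> Hom ?C G" and b: "b \<in> I1 \<rightarrow>\<^sub>E part1 G" and c: "c \<in> I2 \<rightarrow>\<^sub>E part2 G"
        by blast
      have "a \<in> extensional (verts ?C)" "b \<in> extensional I1" "c \<in> extensional I2"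
        using a b c by (auto simp: Hom_def PiE_def)
      moreover have "I1 \<inter> verts ?C = {}" "I2 \<inter> verts ?C = {}" "I1 \<inter> I2 = {}"
        using dj sub by (auto simp: I1_def I2_def verts_def)
      ultimately show "?f (?g y) = y"
        unfolding y using V by (auto simp: fun_eq_iff extensional_def restrict_def)
    qed
    show "?f ` Hom H G \<subseteq> Hom ?C G \<times> (I1 \<rightarrow>\<^sub>E part1 G) \<times> (I2 \<rightarrow>\<^sub>E part2 G)"
    proof (intro image_subsetI SigmaI)
      fix \<phi> assume \<phi>: "\<phi> \<in> Hom H G"
      have p: "\<phi> v \<in> part1 G" if "v \<in> part1 H" for v using \<phi> that by (auto simp: Hom_def)
      have q: "\<phi> v \<in> part2 G" if "v \<in> part2 H" for v using \<phi> that by (auto simp: Hom_def)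
      show "restrict \<phi> (verts ?C) \<in> Hom ?C G"
        using \<phi> p q sub eV by (force simp: Hom_def edges verts_def)
      show "restrict \<phi> I1 \<in> I1 \<rightarrow>\<^sub>E part1 G" using p by (auto simp: I1_def)
      show "restrict \<phi> I2 \<in> I2 \<rightarrow>\<^sub>E part2 G" using q by (auto simp: I2_def)
    qed
    show "?g ` (Hom ?C G \<times> (I1 \<rightarrow>\<^sub>E part1 G) \<times> (I2 \<rightarrow>\<^sub>E part2 G)) \<subseteq> Hom H G"
    proof (rule image_subsetI)
      fix y assume "y \<in> Hom ?C G \<times> (I1 \<rightarrow>\<^sub>E part1 G) \<times> (I2 \<rightarrow>\<^sub>E part2 G)"
      then obtain a b c where y: "y = (a, b, c)"
        and a: "a \<in> Hom ?C G" and b: "b \<in> I1 \<rightarrow>\<^sub>E part1 G" and c: "c \<in> I2 \<rightarrow>\<^sub>E part2 G"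
        by blast
      define \<phi> where "\<phi> = ?g (a, b, c)"
      have d: "I1 \<inter> verts ?C = {}" "I2 \<inter> verts ?C = {}" "I1 \<inter> I2 = {}"
        using dj sub by (auto simp: I1_def I2_def verts_def)
      have p: "\<phi> v \<in> part1 G" if "v \<in> part1 H" for v
      proof (cases "v \<in> part1 ?C")
        case True
        then show ?thesis using a that by (auto simp: \<phi>_def Hom_def verts_def)
      next
        case False
        then have "v \<in> I1" using that by (simp add: I1_def)
        then show ?thesis using b d that by (auto simp: \<phi>_def verts_def)
      qed
      have q: "\<phi> v \<in> part2 G" if "v \<in> part2 H" for v
      proof (cases "v \<in> part2 ?C")
        case True
        then show ?thesis using a that by (auto simp: \<phi>_def Hom_def verts_def)
      next
        case False
        then have "v \<in> I2" using that by (simp add: I2_def)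
        then show ?thesis using c d that by (auto simp: \<phi>_def verts_def)
      qed
      have "(\<phi> v, \<phi> w) \<in> edges G" if e: "(v, w) \<in> edges H" for v w
        using a eV[OF e] sub e by (auto simp: \<phi>_def Hom_def verts_def edges)
      moreover have "\<phi> \<in> extensional (verts H)" by (simp add: \<phi>_def)
      ultimately have "\<phi> \<in> Hom H G"
        using p q by (auto simp: Hom_def PiE_def verts_def)
      then show "?g y \<in> Hom H G" by (simp only: y \<phi>_def)
    qed
  qed
  then have "card (Hom H G) = card (Hom ?C G) * (card (part1 G) ^ card I1 * card (part2 G) ^ card I2)"
    using fin by (subst bij_betw_same_card)
      (auto simp: card_cartesian_product card_PiE I1_def I2_def)
  moreover have "card (part1 H) = card (part1 ?C) + card I1" "card (part2 H) = card (part2 ?C) + card I2"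
    using sub fin by (auto simp: I1_def I2_def card_Diff_subset finite_subset card_mono)
  moreover have "card (part1 G) > 0" "card (part2 G) > 0" using fin G by (auto simp: card_gt_0_iff)
  ultimately show ?thesis by (simp add: hom_density_def power_add field_simps)
qed

section \<open>Asymptotics\<close>

lemma count_round_mset_tendsto:
  assumes fin: "finite (set_pmf p)" and n: "filterlim n at_top sequentially"
  shows "(\<lambda>i. real (count (round_mset (n i) p) x) / real (n i)) \<longlonglongrightarrow> pmf p x"
proof -
  have real_n: "filterlim (\<lambda>i. real (n i)) at_top sequentially"
    using n by (rule filterlim_compose[OF filterlim_real_sequentially])
  have "(\<lambda>i. (1/2) / real (n i)) \<longlonglongrightarrow> 0"
    by (intro real_tendsto_divide_at_top[OF tendsto_const] real_n)
  moreover have "eventually (\<lambda>i. norm (real (count (round_mset (n i) p) x) / real (n i) - pmf p x)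
      \<le> (1/2) / real (n i)) sequentially"
    using filterlim_at_top_dense[THEN iffD1, OF real_n, rule_format, of 0]
  proof eventually_elim
    case (elim i)
    have "\<bar>of_int (round (real (n i) * pmf p x)) - real (n i) * pmf p x\<bar> \<le> 1 / 2"
      by (rule of_int_round_abs_le)
    then have "\<bar>real (count (round_mset (n i) p) x) - real (n i) * pmf p x\<bar> \<le> 1/2"
      by (simp add: count_round_mset[OF fin] round_nonneg)
    moreover have "real (count (round_mset (n i) p) x) / real (n i) - pmf p x
        = (real (count (round_mset (n i) p) x) - real (n i) * pmf p x) / real (n i)"
      using elim by (simp add: field_simps)
    ultimately show ?case
      by (simp only: real_norm_def abs_divide abs_of_nat) (rule divide_right_mono, auto)
  qed
  ultimately have "(\<lambda>i. real (count (round_mset (n i) p) x) / real (n i) - pmf p x) \<longlonglongrightarrow> 0"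
    by (rule Lim_null_comparison[rotated])
  then show ?thesis by (simp add: LIM_zero_iff)
qed

lemma log_over_n_tendsto:
  assumes "filterlim n at_top sequentially"
  shows "(\<lambda>i. c * (1 + ln (real (n i))) / real (n i)) \<longlonglongrightarrow> 0"
proof -
  have "((\<lambda>x::real. c * (1 + ln x) / x) \<longlongrightarrow> 0) at_top" by real_asymp
  moreover have "filterlim (\<lambda>i. real (n i)) at_top sequentially"
    using assms by (rule filterlim_compose[OF filterlim_real_sequentially])
  ultimately show ?thesis by (rule filterlim_compose)
qed

text \<open>The exponential growth rate of a type class is the entropy of the limit of its empirical
  distributions: the error of the counting estimate is \<open>O(ln n)\<close>, and entropy is
  continuous on distributions over the fixed finite set \<open>S\<close>.\<close>

lemma ln_card_permutations_tendsto:
  assumes S: "finite S" "set_pmf p \<subseteq> S" and n: "filterlim n at_top sequentially"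
    and R: "\<forall>\<^sub>F i in sequentially. set_mset (R i) \<subseteq> S \<and> size (R i) = n i"
    and lim: "\<And>x. x \<in> S \<Longrightarrow> (\<lambda>i. real (count (R i) x) / real (n i)) \<longlonglongrightarrow> pmf p x"
  shows "(\<lambda>i. ln (real (card (permutations_of_multiset (R i)))) / real (n i)) \<longlonglongrightarrow> shannon_entropy p"
proof -
  let ?q = "\<lambda>i x. real (count (R i) x) / real (n i)"
  let ?L = "\<lambda>i. ln (real (card (permutations_of_multiset (R i)))) / real (n i)"
  let ?E = "\<lambda>i. - (\<Sum>x\<in>S. ?q i x * ln (?q i x))"
  \<comment> \<open>Continuity of \<open>x * ln x\<close> at 0 is included, as \<open>S\<close> may
    contain points of limit mass 0.\<close>
  have "(\<lambda>i. ?q i x * ln (?q i x)) \<longlonglongrightarrow> pmf p x * ln (pmf p x)" if "x \<in> S" for x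
    using continuous_on_tendsto_compose[OF continuous_on_xlnx lim[OF that]] by simp
  then have "?E \<longlonglongrightarrow> - (\<Sum>x\<in>S. pmf p x * ln (pmf p x))"
    by (intro tendsto_minus tendsto_sum)
  then have E: "?E \<longlonglongrightarrow> shannon_entropy p"
    using S by (simp add: shannon_entropy_superset)
  have pos: "\<forall>\<^sub>F i in sequentially. n i > 0"
    by (rule eventually_compose_filterlim[OF eventually_gt_at_top n])
  have "\<forall>\<^sub>F i in sequentially. norm (?L i - ?E i) \<le> (real (card S) + 1) * (1 + ln (real (n i))) / real (n i)"
    using R pos
  proof eventually_elim
    case (elim i)
    then have ne: "R i \<noteq> {#}" by auto
    have "?E i = shannon_entropy (pmf_of_multiset (R i))"
      using S elim ne by (subst shannon_entropy_superset[of S]) auto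
    moreover have "\<bar>ln (real (card (permutations_of_multiset (R i))))
        - real (n i) * shannon_entropy (pmf_of_multiset (R i))\<bar> \<le> (real (card S) + 1) * (1 + ln (real (n i)))"
      using ln_card_permutations_of_multiset[OF S(1) conjunct1[OF elim(1)] ne] elim by simp
    moreover have "?L i - shannon_entropy (pmf_of_multiset (R i))
        = (ln (real (card (permutations_of_multiset (R i))))
           - real (n i) * shannon_entropy (pmf_of_multiset (R i))) / real (n i)"
      using elim by (simp add: field_simps)
    ultimately show ?case using elim by (simp add: divide_right_mono)
  qed
  then have "(\<lambda>i. ?L i - ?E i) \<longlonglongrightarrow> 0"
    using log_over_n_tendsto[OF n] by (rule Lim_null_comparison)
  from tendsto_add[OF this E] show ?thesis by simp
qed

section \<open>Empirical marginals, densities of the single edge, and finiteness of the set of small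
  graphs\<close>

lemma card_permutations_of_multiset_pos: "card (permutations_of_multiset M) > 0"
  by (simp add: card_gt_0_iff)

lemma map_pmf_of_multiset:
  assumes "R \<noteq> {#}"
  shows "map_pmf g (pmf_of_multiset R) = pmf_of_multiset (image_mset g R)"
proof (rule pmf_eqI)
  fix y
  have "pmf (map_pmf g (pmf_of_multiset R)) y
      = (\<Sum>x | x \<in> set_mset R \<and> g x = y. real (count R x) / real (size R))"
    using assms by (subst pmf_map_finite_support[of "set_mset R"]) auto
  also have "\<dots> = real (count (image_mset g R) y) / real (size R)"
    by (simp add: count_image_mset_superset[of "set_mset R"] sum_divide_distrib)
  finally show "pmf (map_pmf g (pmf_of_multiset R)) y = pmf (pmf_of_multiset (image_mset g R)) y"
    using assms by simp
qed

lemma card_Hom_P\<^sub>1: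
  assumes "bipartite_graph G"
  shows "card (Hom P\<^sub>1 G) = card (edges G)"
proof -
  have E: "x \<in> part1 G" "y \<in> part2 G" if "(x, y) \<in> edges G" for x y
    using that assms by (auto simp: bipartite_graph_def)
  have "bij_betw (\<lambda>\<phi>. (\<phi> 0, \<phi> 1)) (Hom P\<^sub>1 G) (edges G)"
    by (rule bij_betw_byWitness[where f' = "\<lambda>(x, y). \<lambda>i\<in>{0, 1::nat}. if i = 0 then x else y"])
      (auto simp: Hom_def P\<^sub>1_def verts_def PiE_def extensional_def fun_eq_iff dest: E)
  then show ?thesis by (rule bij_betw_same_card)
qed

text \<open>Used in the contrapositive: where the logarithmic density of the edge is nonzero, the
  graph is not complete and \<open>h\<close> is given by the quotient.\<close>

lemma log_density_P\<^sub>1_complete: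
  assumes "bipartite_graph G" "edges G \<noteq> {}" "edges G = part1 G \<times> part2 G"
  shows "log_density P\<^sub>1 G = 0"
proof -
  have "card (part1 G) > 0" "card (part2 G) > 0"
    using assms by (auto simp: bipartite_graph_def card_gt_0_iff)
  then have "hom_density P\<^sub>1 G = 1"
    using card_Hom_P\<^sub>1[OF assms(1)]
    by (simp add: hom_density_def assms(3) card_cartesian_product) (simp add: P\<^sub>1_def)
  then show ?thesis by (simp add: log_density_def)
qed

lemma log_density_eq:
  assumes "card (Hom H G) > 0" "card (part1 G) > 0" "card (part2 G) > 0"
  shows "log_density H G = - ln (real (card (Hom H G)))
    + (real (card (part1 H)) * ln (real (card (part1 G))) + real (card (part2 H)) * ln (real (card (part2 G))))"
  using assms by (simp add: log_density_def hom_density_def ln_div ln_mult ln_realpow)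

lemma P\<^sub>1_in_\<B>\<^sub>0: "P\<^sub>1 \<in> \<B>\<^sub>0" "no_isolated P\<^sub>1"
  by (auto simp: P\<^sub>1_def \<B>\<^sub>0_def \<B>_def bipartite_graph_def no_isolated_def)

lemma finite_range_pmf: "finite (set_pmf p) \<Longrightarrow> finite (range (pmf p))"
  by (rule finite_subset[of _ "insert 0 (pmf p ` set_pmf p)"]) (auto simp: set_pmf_iff)

text \<open>Keeps each stage of the rounding construction below a finite approximation
  problem.\<close>

lemma finite_graphs_on: "finite V \<Longrightarrow> finite {H \<in> \<B>. verts H \<subseteq> V}"
proof -
  assume V: "finite V"
  show ?thesis
  proof (rule finite_subset)
    show "{H \<in> \<B>. verts H \<subseteq> V}
      \<subseteq> (\<lambda>(a, b, c). \<lparr>part1 = a, part2 = b, edges = c\<rparr>) ` (Pow V \<times> Pow V \<times> Pow (V \<times> V))"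
    proof
      fix H assume "H \<in> {H \<in> \<B>. verts H \<subseteq> V}"
      then have "part1 H \<subseteq> V" "part2 H \<subseteq> V" "edges H \<subseteq> V \<times> V"
        by (auto simp: \<B>_def bipartite_graph_def verts_def)
      then show "H \<in> (\<lambda>(a, b, c). \<lparr>part1 = a, part2 = b, edges = c\<rparr>) ` (Pow V \<times> Pow V \<times> Pow (V \<times> V))"
        by (intro image_eqI[of _ _ "(part1 H, part2 H, edges H)"]) auto
    qed
  qed (use V in auto)
qed

section \<open>Choice of the sequence lengths and limits of the densities\<close>

context type_graph
begin

text \<open>A labelling of \<open>P\<^sub>1\<close> is just a pair of values, so a maximiser in
  \<open>Q F1 F2 P\<^sub>1 X\<close> has the entropy of \<open>X\<close>. Thus \<open>dstar\<close>
  of the edge is the mutual information of the pair, which is positive for dependent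
  variables.\<close>

lemma dstar_P\<^sub>1_pos:
  assumes X: "set_pmf X \<subseteq> F1 \<times> F2" and dep: "X \<noteq> pair_pmf (map_pmf fst X) (map_pmf snd X)"
  shows "dstar F1 F2 P\<^sub>1 X > 0"
proof -
  have "bipartite_graph P\<^sub>1" using P\<^sub>1_in_\<B>\<^sub>0 by (simp add: \<B>\<^sub>0_def \<B>_def)
  then obtain p where p: "p \<in> Q F1 F2 P\<^sub>1 X" "shannon_entropy p = max_entropy F1 F2 P\<^sub>1 X"
    using max_entropy_attained[OF _ finite_F X] by blast
  have "inj_on (marginal (0, 1)) ((part1 P\<^sub>1 \<rightarrow>\<^sub>E F1) \<times> (part2 P\<^sub>1 \<rightarrow>\<^sub>E F2))"
  proof (rule inj_onI)
    fix s s' assume s: "s \<in> (part1 P\<^sub>1 \<rightarrow>\<^sub>E F1) \<times> (part2 P\<^sub>1 \<rightarrow>\<^sub>E F2)"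
      "s' \<in> (part1 P\<^sub>1 \<rightarrow>\<^sub>E F1) \<times> (part2 P\<^sub>1 \<rightarrow>\<^sub>E F2)"
      and eq: "marginal (0, 1) s = marginal (0, 1) s'"
    have val: "fst s 0 = fst s' 0" "snd s 1 = snd s' 1" using eq by (simp_all add: marginal_def)
    have mem: "fst s \<in> {0} \<rightarrow>\<^sub>E F1" "fst s' \<in> {0} \<rightarrow>\<^sub>E F1" "snd s \<in> {1} \<rightarrow>\<^sub>E F2" "snd s' \<in> {1} \<rightarrow>\<^sub>E F2"
      using s by (simp_all add: P\<^sub>1_def mem_Times_iff)
    have "fst s = fst s'" using mem(1,2) by (rule PiE_ext) (use val in simp)
    moreover have "snd s = snd s'" using mem(3,4) by (rule PiE_ext) (use val in simp)
    ultimately show "s = s'" by (rule prod_eqI)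
  qed
  then have "inj_on (marginal (0, 1)) (set_pmf p)"
    by (rule inj_on_subset) (use p(1) in \<open>simp add: Q_altdef\<close>)
  moreover have "map_pmf (marginal (0, 1)) p = X"
    using p(1) by (simp add: Q_altdef P\<^sub>1_def)
  ultimately have "shannon_entropy p = shannon_entropy X"
    by (metis shannon_entropy_map_pmf_inj)
  moreover have "finite (set_pmf X)" using X finite_F by (meson finite_SigmaI finite_subset)
  ultimately show ?thesis
    using shannon_entropy_less_marginals[OF _ dep] p(2) by (simp add: dstar_def P\<^sub>1_def)
qed

text \<open>A diagonal choice: stage \<open>i\<close> treats all graphs on \<open>{..<i}\<close> at
  once, so a fixed graph with an edge is covered from some stage on. Rounding all the chosen
  distributions with the same \<open>n\<close> preserves their edge marginals exactly.\<close>

lemma rounding_sequence: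
  assumes X: "set_pmf X \<subseteq> F1 \<times> F2" and p: "\<And>H. H \<in> \<B> \<Longrightarrow> p H \<in> Q F1 F2 H X"
  obtains n :: "nat \<Rightarrow> nat" where "\<And>i. n i > i" "\<And>i. size (round_mset (n i) X) = n i"
    "\<And>i H. H \<in> \<B> \<Longrightarrow> verts H \<subseteq> {..<i} \<Longrightarrow> edges H \<noteq> {} \<Longrightarrow>
       round_mset (n i) (p H) \<in> hom_types H (round_mset (n i) X)"
proof -
  have "\<exists>n. n > i \<and> size (round_mset n X) = n \<and> (\<forall>H\<in>\<B>. verts H \<subseteq> {..<i} \<longrightarrow> edges H \<noteq> {} \<longrightarrow>
       round_mset n (p H) \<in> hom_types H (round_mset n X))" for i
  proof -
    define \<H> where "\<H> = {H \<in> \<B>. verts H \<subseteq> {..<i}}"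
    \<comment> \<open>\<open>Y\<close> gathers every probability to be rounded. The number
      \<open>c\<close> bounds the sizes of all outcome sets involved, so the single tolerance
      \<open>1 / (c + 1)\<close> suits each of the roundings.\<close>
    define Y where "Y = range (pmf X) \<union> (\<Union>H\<in>\<H>. range (pmf (p H)))"
    define c where "c = card (F1 \<times> F2) + (\<Sum>H\<in>\<H>. card (labellings H))"
    have fin\<H>: "finite \<H>" unfolding \<H>_def by (rule finite_graphs_on) simp
    have finX: "finite (set_pmf X)" using X finite_F by (meson finite_SigmaI finite_subset)
    have pH: "set_pmf (p H) \<subseteq> labellings H" "finite (labellings H)"
      and marg: "\<And>e. e \<in> edges H \<Longrightarrow> map_pmf (marginal e) (p H) = X" if "H \<in> \<H>" for H
      using p[of H] that finite_labellings[of H] by (auto simp: Q_altdef labellings_def \<H>_def \<B>_def)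
    have "finite Y"
      unfolding Y_def using fin\<H> finX pH
      by (intro finite_UnI finite_UN_I finite_range_pmf) (auto intro: finite_subset)
    then obtain n where n: "n > i" "\<And>y. y \<in> Y \<Longrightarrow> \<bar>real n * y - of_int (round (real n * y))\<bar> < 1 / (real c + 1)"
      by (rule simultaneous_approximation[of Y "1 / (real c + 1)" i]) auto
    have near: "\<bar>real n * y - of_int (round (real n * y))\<bar> < 1 / (real k + 1)" if "y \<in> Y" "k \<le> c" for y k
    proof -
      have "1 / (real c + 1) \<le> 1 / (real k + 1)" using that(2) by (intro divide_left_mono) auto
      then show ?thesis using n(2)[OF that(1)] by linarith
    qed
    have "size (round_mset n X) = n"
      using finite_F X by (intro size_round_mset[of "F1 \<times> F2"] near) (auto simp: Y_def c_def)
    moreover have "round_mset n (p H) \<in> hom_types H (round_mset n X)"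
      if H: "H \<in> \<B>" "verts H \<subseteq> {..<i}" "edges H \<noteq> {}" for H
    proof -
      have H': "H \<in> \<H>" using H by (simp add: \<H>_def)
      have c: "card (labellings H) \<le> c"
        using member_le_sum[of H \<H> "\<lambda>H. card (labellings H)"] fin\<H> H' by (simp add: c_def)
      have im: "image_mset (marginal e) (round_mset n (p H)) = round_mset n X" if "e \<in> edges H" for e
      proof (rule image_round_mset[OF pH(2,1)[OF H'] marg[OF H' that]])
        show "\<bar>real n * pmf (p H) x - of_int (round (real n * pmf (p H) x))\<bar>
            < 1 / (real (card (labellings H)) + 1)" for x
          using H' c by (intro near) (auto simp: Y_def)
        show "\<bar>real n * pmf X y - of_int (round (real n * pmf X y))\<bar>
            < 1 / (real (card (labellings H)) + 1)" for y
          using c by (intro near) (auto simp: Y_def)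
      qed
      \<comment> \<open>Taking images preserves the size, so the marginal at any one edge settles
        it.\<close>
      moreover have "size (round_mset n (p H)) = size (round_mset n X)"
        using H(3) im by (metis size_image_mset ex_in_conv)
      moreover have "set_mset (round_mset n (p H)) \<subseteq> labellings H"
        using set_round_mset[of "p H" n] pH[OF H'] finite_subset by blast
      ultimately show ?thesis by (simp add: hom_types_def)
    qed
    ultimately show ?thesis using n(1) by blast
  qed
  then obtain n where "\<And>i. n i > i \<and> size (round_mset (n i) X) = n i \<and>
      (\<forall>H\<in>\<B>. verts H \<subseteq> {..<i} \<longrightarrow> edges H \<noteq> {} \<longrightarrow>
        round_mset (n i) (p H) \<in> hom_types H (round_mset (n i) X))"
    by metis
  then show ?thesis using that by blast
qed

text \<open>The type of \<open>X\<close> is only approximated by the types of the graphs; continuity of the maximal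
  entropy from above is a compactness argument, continuity from below holds because the maximiser
  has been rounded along with \<open>X\<close>.\<close>

lemma ln_card_Hom_tendsto:
  assumes X: "set_pmf X \<subseteq> F1 \<times> F2" and H: "bipartite_graph H" "no_isolated H" "edges H \<noteq> {}"
    and n: "filterlim n at_top sequentially" and size: "\<And>i. size (round_mset (n i) X) = n i"
    and p: "p \<in> Q F1 F2 H X" "shannon_entropy p = max_entropy F1 F2 H X"
    and R: "\<forall>\<^sub>F i in sequentially. round_mset (n i) p \<in> hom_types H (round_mset (n i) X)"
  shows "(\<lambda>i. ln (real (card (Hom H (graph (round_mset (n i) X))))) / real (n i)) \<longlonglongrightarrow> max_entropy F1 F2 H X"
    and "\<forall>\<^sub>F i in sequentially. card (Hom H (graph (round_mset (n i) X))) > 0"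
proof -
  let ?S = "labellings H" and ?m = "max_entropy F1 F2 H X"
  let ?A = "\<lambda>i. round_mset (n i) X"
  let ?L = "\<lambda>i. ln (real (card (Hom H (graph (?A i))))) / real (n i)"
  have finS: "finite ?S" by (rule finite_labellings[OF H(1)])
  have finX: "finite (set_pmf X)" using X finite_F by (meson finite_SigmaI finite_subset)
  have A: "set_mset (?A i) \<subseteq> F1 \<times> F2" for i using set_round_mset[OF finX] X by blast
  have pS: "set_pmf p \<subseteq> ?S" using p(1) by (simp add: Q_altdef labellings_def)
  have finp: "finite (set_pmf p)" using pS finS finite_subset by blast
  have finE: "finite (edges H)"
    using H(1) unfolding bipartite_graph_def by (auto intro: finite_subset[OF _ finite_cartesian_product])
  have pos: "\<forall>\<^sub>F i in sequentially. n i > 0"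
    by (rule eventually_compose_filterlim[OF eventually_gt_at_top n])
  show ev_pos: "\<forall>\<^sub>F i in sequentially. card (Hom H (graph (?A i))) > 0"
    using R
  proof eventually_elim
    case (elim i)
    show ?case by (rule less_le_trans[OF card_permutations_of_multiset_pos card_Hom_ge[OF H(1,2) A elim]])
  qed
  show "?L \<longlonglongrightarrow> ?m"
  proof (rule order_tendstoI)
    fix a assume "a < ?m"
    have "(\<lambda>i. ln (real (card (permutations_of_multiset (round_mset (n i) p)))) / real (n i))
        \<longlonglongrightarrow> shannon_entropy p"
    proof (rule ln_card_permutations_tendsto[OF finS pS n])
      show "\<forall>\<^sub>F i in sequentially. set_mset (round_mset (n i) p) \<subseteq> ?S \<and> size (round_mset (n i) p) = n i"
        using R by eventually_elim (simp add: hom_types_def size)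
    qed (rule count_round_mset_tendsto[OF finp n])
    then have "\<forall>\<^sub>F i in sequentially. a < ln (real (card (permutations_of_multiset (round_mset (n i) p)))) / real (n i)"
      using \<open>a < ?m\<close> p(2) by (intro order_tendstoD(1)) auto
    then show "\<forall>\<^sub>F i in sequentially. a < ?L i"
      using R
    proof eventually_elim
      case (elim i)
      have "ln (real (card (permutations_of_multiset (round_mset (n i) p)))) \<le> ln (real (card (Hom H (graph (?A i)))))"
        using card_Hom_ge[OF H(1,2) A elim(2)] card_permutations_of_multiset_pos by (intro ln_mono) (auto intro: less_le_trans)
      then show ?case
        using elim(1) by (meson divide_right_mono of_nat_0_le_iff less_le_trans)
    qed
  next
    fix a assume "?m < a"
    \<comment> \<open>The entropy of the dominant type is kept below \<open>b\<close>; the gap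
      \<open>a - b\<close> then absorbs the number of types and the Stirling error.\<close>
    then obtain b where b: "?m < b" "b < a" using dense by blast
    obtain \<delta> where \<delta>: "\<delta> > 0"
      "\<And>q. set_pmf q \<subseteq> ?S \<Longrightarrow> (\<Sum>e\<in>edges H. \<Sum>y\<in>F1 \<times> F2. \<bar>pmf (map_pmf (marginal e) q) y - pmf X y\<bar>) < \<delta>
        \<Longrightarrow> shannon_entropy q < b"
    proof (rule shannon_entropy_less_near_marginals[of ?S "F1 \<times> F2" "edges H" marginal X b])
      show "marginal e ` ?S \<subseteq> F1 \<times> F2" if "e \<in> edges H" for e
        using that H(1) by (fastforce simp: marginal_def labellings_def bipartite_graph_def)
      show "shannon_entropy q < b"
        if "set_pmf q \<subseteq> ?S" "\<And>e. e \<in> edges H \<Longrightarrow> map_pmf (marginal e) q = X" for q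
      proof -
        have "q \<in> Q F1 F2 H X" using that by (simp add: Q_altdef labellings_def)
        then have "shannon_entropy q \<le> ?m"
          using max_entropy_attained[OF H(1) finite_F X] by metis
        then show ?thesis using b by simp
      qed
    qed (use finS finite_F finE X in auto)
    let ?D = "\<lambda>i. \<Sum>e\<in>edges H. \<Sum>y\<in>F1 \<times> F2. \<bar>real (count (?A i) y) / real (n i) - pmf X y\<bar>"
    have "?D \<longlonglongrightarrow> (\<Sum>e\<in>edges H. \<Sum>y\<in>F1 \<times> F2. \<bar>pmf X y - pmf X y\<bar>)"
      by (intro tendsto_intros count_round_mset_tendsto[OF finX n])
    then have "\<forall>\<^sub>F i in sequentially. ?D i < \<delta>"
      using \<delta>(1) by (intro order_tendstoD(2)) auto
    moreover
    let ?err = "\<lambda>i. real (card ?S) * ln (real (n i) + 1) / real (n i)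
      + (real (card ?S) + 1) * (1 + ln (real (n i))) / real (n i)"
    have "((\<lambda>x::real. real (card ?S) * ln (x + 1) / x) \<longlongrightarrow> 0) at_top" by real_asymp
    then have "(\<lambda>i. real (card ?S) * ln (real (n i) + 1) / real (n i)) \<longlonglongrightarrow> 0"
      by (rule filterlim_compose) (rule filterlim_compose[OF filterlim_real_sequentially n])
    from tendsto_add[OF this log_over_n_tendsto[OF n, of "real (card ?S) + 1"]]
    have "?err \<longlonglongrightarrow> 0" by simp
    then have "\<forall>\<^sub>F i in sequentially. ?err i < a - b"
      using b by (intro order_tendstoD(2)) auto
    ultimately show "\<forall>\<^sub>F i in sequentially. ?L i < a"
      using R pos ev_pos
    proof eventually_elim
      case (elim i)
      \<comment> \<open>\<open>M\<close> is a dominant type. Its empirical distribution has all edge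
        marginals equal to that of \<open>?A i\<close>, which is close to \<open>X\<close>, so the
        choice of \<open>\<delta>\<close> bounds its entropy.\<close>
      obtain M where M: "M \<in> hom_types H (?A i)"
        "card (Hom H (graph (?A i))) \<le> (size (?A i) + 1) ^ card ?S * card (permutations_of_multiset M)"
        using card_Hom_le[OF H(1,2) A] elim(3) by blast
      have MS: "set_mset M \<subseteq> ?S" "size M = n i" and marg: "\<And>e. e \<in> edges H \<Longrightarrow> image_mset (marginal e) M = ?A i"
        using M(1) by (auto simp: hom_types_def size)
      have ne: "M \<noteq> {#}" "?A i \<noteq> {#}" using MS size[of i] elim(4) by auto
      have "(\<Sum>e\<in>edges H. \<Sum>y\<in>F1 \<times> F2. \<bar>pmf (map_pmf (marginal e) (pmf_of_multiset M)) y - pmf X y\<bar>) = ?D i"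
        using ne by (intro sum.cong refl) (simp add: map_pmf_of_multiset marg size)
      then have ent: "shannon_entropy (pmf_of_multiset M) < b"
        using \<delta>(2)[of "pmf_of_multiset M"] ne MS elim(1) by simp
      have "ln (real (card (Hom H (graph (?A i))))) \<le> ln (real ((n i + 1) ^ card ?S * card (permutations_of_multiset M)))"
        using M(2) elim(5) size by (intro ln_mono) (auto simp del: of_nat_mult of_nat_power)
      also have "\<dots> = real (card ?S) * ln (real (n i) + 1) + ln (real (card (permutations_of_multiset M)))"
        using card_permutations_of_multiset_pos[of M] by (simp add: ln_mult ln_realpow add.commute)
      also have "ln (real (card (permutations_of_multiset M)))
          \<le> real (n i) * shannon_entropy (pmf_of_multiset M) + (real (card ?S) + 1) * (1 + ln (real (n i)))"
        using ln_card_permutations_of_multiset[OF finS MS(1) ne(1)] MS(2) by (simp add: abs_le_iff)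
      also have "real (n i) * shannon_entropy (pmf_of_multiset M) \<le> real (n i) * b"
        using ent by (intro mult_left_mono) auto
      finally have "?L i \<le> (real (card ?S) * ln (real (n i) + 1)
          + (real (n i) * b + (real (card ?S) + 1) * (1 + ln (real (n i))))) / real (n i)"
        by (intro divide_right_mono) auto
      also have "\<dots> = b + ?err i"
        using elim(4) by (simp add: add_divide_distrib)
      finally show ?case using elim(2) by linarith
    qed
  qed
qed

text \<open>With \<open>fst\<close> and \<open>snd\<close> for \<open>f\<close> this gives the
  growth of the two vertex classes. Their types are images of the rounded \<open>X\<close>, not
  roundings of its marginals, so convergence of the frequencies is obtained by summing over
  fibres.\<close>

lemma ln_card_marginal_tendsto:
  assumes X: "set_pmf X \<subseteq> F1 \<times> F2" and T: "finite T" "f ` (F1 \<times> F2) \<subseteq> T"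
    and n: "filterlim n at_top sequentially" and size: "\<And>i. size (round_mset (n i) X) = n i"
  shows "(\<lambda>i. ln (real (card (permutations_of_multiset (image_mset f (round_mset (n i) X))))) / real (n i))
    \<longlonglongrightarrow> shannon_entropy (map_pmf f X)"
proof (rule ln_card_permutations_tendsto[OF T(1) _ n])
  have finX: "finite (set_pmf X)" using X finite_F by (meson finite_SigmaI finite_subset)
  have A: "set_mset (round_mset (n i) X) \<subseteq> set_pmf X" for i using set_round_mset[OF finX] by blast
  show "set_pmf (map_pmf f X) \<subseteq> T" using X T by auto
  have "f ` set_mset (round_mset (n i) X) \<subseteq> T" for i using A[of i] X T(2) by blast
  then show "\<forall>\<^sub>F i in sequentially. set_mset (image_mset f (round_mset (n i) X)) \<subseteq> T
      \<and> size (image_mset f (round_mset (n i) X)) = n i"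
    by (simp add: size)
  fix y
  have "(\<lambda>i. \<Sum>x | x \<in> set_pmf X \<and> f x = y. real (count (round_mset (n i) X) x) / real (n i))
      \<longlonglongrightarrow> (\<Sum>x | x \<in> set_pmf X \<and> f x = y. pmf X x)"
    by (intro tendsto_sum count_round_mset_tendsto[OF finX n])
  then show "(\<lambda>i. real (count (image_mset f (round_mset (n i) X)) y) / real (n i)) \<longlonglongrightarrow> pmf (map_pmf f X) y"
    by (simp add: pmf_map_finite_support[OF finX order_refl] count_image_mset_superset[OF finX A]
        sum_divide_distrib)
qed

text \<open>Divided by \<open>n i\<close>, the logarithmic densities of \<open>H\<close> and of the
  edge converge to the corresponding values of \<open>dstar\<close>. The limit for the edge is
  positive, so the quotients converge too.\<close>

lemma exists_log_convergent_sequence: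
  assumes X: "set_pmf X \<subseteq> F1 \<times> F2" and dep: "X \<noteq> pair_pmf (map_pmf fst X) (map_pmf snd X)"
  shows "\<exists>G :: nat \<Rightarrow> nat bigraph.
           log_convergent G \<and>
           (\<forall>i. edge_vertex_transitive (G i)) \<and>
           (\<forall>H \<in> \<B>\<^sub>0. no_isolated H \<longrightarrow> (\<lambda>i. h H (G i)) \<longlonglongrightarrow> hstar F1 F2 H X)"
proof -
  have "\<exists>p. p \<in> Q F1 F2 H X \<and> shannon_entropy p = max_entropy F1 F2 H X" if "H \<in> \<B>" for H
    using that max_entropy_attained[OF _ finite_F X, of H] unfolding \<B>_def by blast
  then obtain p where p: "\<And>H. H \<in> \<B> \<Longrightarrow> p H \<in> Q F1 F2 H X"
    "\<And>H. H \<in> \<B> \<Longrightarrow> shannon_entropy (p H) = max_entropy F1 F2 H X"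
    by metis
  obtain n :: "nat \<Rightarrow> nat" where n: "\<And>i. n i > i" "\<And>i. size (round_mset (n i) X) = n i"
    "\<And>i H. H \<in> \<B> \<Longrightarrow> verts H \<subseteq> {..<i} \<Longrightarrow> edges H \<noteq> {} \<Longrightarrow>
       round_mset (n i) (p H) \<in> hom_types H (round_mset (n i) X)"
    using rounding_sequence[OF X p(1)] by blast
  define G where "G = (\<lambda>i. graph (round_mset (n i) X))"
  have n_lim: "filterlim n at_top sequentially"
    by (rule filterlim_at_top_mono[OF filterlim_ident]) (auto intro!: always_eventually less_imp_le n(1))
  have n_pos: "n i > 0" for i using n(1)[of i] by simp
  have finX: "finite (set_pmf X)" using X finite_F by (meson finite_SigmaI finite_subset)
  have A: "set_mset (round_mset (n i) X) \<subseteq> F1 \<times> F2" for i using set_round_mset[OF finX] X by blast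
  have bip: "bipartite_graph (G i)" and ne: "edges (G i) \<noteq> {}" and trans: "edge_vertex_transitive (G i)" for i
    unfolding G_def by (rule bipartite_graph[OF A] edges_nonempty[OF A] edge_vertex_transitive[OF A])+
  have parts_ne: "part1 (G i) \<noteq> {}" "part2 (G i) \<noteq> {}" for i
    using bip[of i] ne[of i] by (auto simp: bipartite_graph_def)
  have parts_pos: "card (part1 (G i)) > 0" "card (part2 (G i)) > 0" for i
    using bip[of i] parts_ne[of i] by (auto simp: bipartite_graph_def card_gt_0_iff)
  have N1: "(\<lambda>i. ln (real (card (part1 (G i)))) / real (n i)) \<longlonglongrightarrow> shannon_entropy (map_pmf fst X)"
    unfolding G_def card_parts[OF A]
    by (rule ln_card_marginal_tendsto[OF X finite_F(1) _ n_lim n(2)]) auto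
  have N2: "(\<lambda>i. ln (real (card (part2 (G i)))) / real (n i)) \<longlonglongrightarrow> shannon_entropy (map_pmf snd X)"
    unfolding G_def card_parts[OF A]
    by (rule ln_card_marginal_tendsto[OF X finite_F(2) _ n_lim n(2)]) auto
  have d: "(\<lambda>i. log_density H (G i) / real (n i)) \<longlonglongrightarrow> dstar F1 F2 H X"
    if H: "H \<in> \<B>\<^sub>0" "no_isolated H" for H
  proof -
    have H': "H \<in> \<B>" "bipartite_graph H" "edges H \<noteq> {}" using H by (auto simp: \<B>\<^sub>0_def \<B>_def)
    have "finite (verts H)" using H'(2) by (simp add: bipartite_graph_def verts_def)
    \<comment> \<open>From stage \<open>k\<close> on, \<open>H\<close> is among the graphs whose
      maximiser was rounded.\<close>
    then obtain k where k: "verts H \<subseteq> {..<k}" using finite_nat_iff_bounded by blast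
    have R: "\<forall>\<^sub>F i in sequentially. round_mset (n i) (p H) \<in> hom_types H (round_mset (n i) X)"
    proof (rule eventually_sequentiallyI)
      fix i assume "k \<le> i"
      then have "verts H \<subseteq> {..<i}" using k by auto
      then show "round_mset (n i) (p H) \<in> hom_types H (round_mset (n i) X)"
        by (rule n(3)[OF H'(1) _ H'(3)])
    qed
    note lim = ln_card_Hom_tendsto[OF X H'(2) H(2) H'(3) n_lim n(2) p[OF H'(1)] R, folded G_def]
    have "(\<lambda>i. - (ln (real (card (Hom H (G i)))) / real (n i))
        + (real (card (part1 H)) * (ln (real (card (part1 (G i)))) / real (n i))
          + real (card (part2 H)) * (ln (real (card (part2 (G i)))) / real (n i))))
      \<longlonglongrightarrow> dstar F1 F2 H X"
      unfolding dstar_def using lim(1) N1 N2 by (intro tendsto_intros) (simp_all add: G_def)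
    then show ?thesis
    proof (rule Lim_transform_eventually)
      show "\<forall>\<^sub>F i in sequentially. - (ln (real (card (Hom H (G i)))) / real (n i))
        + (real (card (part1 H)) * (ln (real (card (part1 (G i)))) / real (n i))
          + real (card (part2 H)) * (ln (real (card (part2 (G i)))) / real (n i)))
        = log_density H (G i) / real (n i)"
        using lim(2)
      proof eventually_elim
        case (elim i)
        then have "card (Hom H (G i)) > 0" by (simp add: G_def)
        from log_density_eq[OF this parts_pos] show ?case
          by (simp add: add_divide_distrib diff_divide_distrib)
      qed
    qed
  qed
  have d1: "dstar F1 F2 P\<^sub>1 X > 0" by (rule dstar_P\<^sub>1_pos[OF X dep])
  \<comment> \<open>The logarithmic density of the edge is eventually positive, which excludes the
    exceptional case in the definition of \<open>h\<close>.\<close>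
  have incomplete: "\<forall>\<^sub>F i in sequentially. edges (G i) \<noteq> part1 (G i) \<times> part2 (G i)"
    using order_tendstoD(1)[OF d[OF P\<^sub>1_in_\<B>\<^sub>0] d1]
    by eventually_elim (use log_density_P\<^sub>1_complete[OF bip ne] in fastforce)
  have lim: "(\<lambda>i. h H (G i)) \<longlonglongrightarrow> hstar F1 F2 H X" if H: "H \<in> \<B>\<^sub>0" "no_isolated H" for H
  proof -
    have "(\<lambda>i. (log_density H (G i) / real (n i)) / (log_density P\<^sub>1 (G i) / real (n i)))
        \<longlonglongrightarrow> dstar F1 F2 H X / dstar F1 F2 P\<^sub>1 X"
      using d1 by (intro tendsto_divide d H P\<^sub>1_in_\<B>\<^sub>0) auto
    then have "(\<lambda>i. log_density H (G i) / log_density P\<^sub>1 (G i)) \<longlonglongrightarrow> hstar F1 F2 H X"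
      using dep n_pos by (simp add: hstar_def less_imp_neq[THEN not_sym])
    then show ?thesis
      by (rule Lim_transform_eventually) (use incomplete in eventually_elim, simp add: h_def)
  qed
  have "convergent (\<lambda>i. h H (G i))" if H: "H \<in> \<B>\<^sub>0" for H
  proof -
    have "bipartite_graph H" using H by (simp add: \<B>\<^sub>0_def \<B>_def)
    \<comment> \<open>Both branches of \<open>h\<close> agree: the core has the same density and the
      same edges.\<close>
    then have "h H (G i) = h (edge_core H) (G i)" for i
      by (simp add: h_def log_density_def hom_density_edge_core[OF _ bip parts_ne])
        (simp add: edge_core_def)
    then show ?thesis
      using lim[OF edge_core_in_\<B>\<^sub>0[OF H] no_isolated_edge_core] by (auto simp: convergent_def)
  qed
  then have "log_convergent G"
    unfolding log_convergent_def using bip ne by (simp add: \<B>\<^sub>0_def \<B>_def)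
  then show ?thesis using trans lim by blast
qed

end

section \<open>Encoding of sequences and the final case distinction\<close>

lemma exists_type_graph:
  assumes "finite F1" "finite F2"
  obtains c1 :: "'a list \<Rightarrow> nat" and c2 :: "'b list \<Rightarrow> nat" where "type_graph F1 F2 c1 c2"
proof -
  obtain f1 :: "'a \<Rightarrow> nat" and f2 :: "'b \<Rightarrow> nat" where f: "inj_on f1 F1" "inj_on f2 F2"
    using assms by (meson finite_imp_inj_to_nat_seg)
  \<comment> \<open>Even codes for one class and odd codes for the other keep the classes
    disjoint.\<close>
  define c1 where "c1 = (\<lambda>xs. 2 * to_nat (map f1 xs))"
  define c2 where "c2 = (\<lambda>ys. 2 * to_nat (map f2 ys) + 1)"
  have "inj_on (map f1) (lists F1)" "inj_on (map f2) (lists F2)"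
    using f by (auto intro!: inj_on_mapI elim!: inj_on_subset)
  then have "type_graph F1 F2 c1 c2"
    using assms by unfold_locales (auto simp: c1_def c2_def inj_on_def, presburger)
  then show ?thesis by (rule that)
qed

theorem theorem1:
  fixes X :: "('a \<times> 'b) pmf" and F1 :: "'a set" and F2 :: "'b set"
  assumes "finite F1" and "finite F2" and "set_pmf X \<subseteq> F1 \<times> F2"
  shows "\<exists>G :: nat \<Rightarrow> nat bigraph.
           log_convergent G \<and>
           (\<forall>i. edge_vertex_transitive (G i)) \<and>
           (\<forall>H \<in> \<B>\<^sub>0. no_isolated H \<longrightarrow> (\<lambda>i. h H (G i)) \<longlonglongrightarrow> hstar F1 F2 H X)"
proof (cases "X = pair_pmf (map_pmf fst X) (map_pmf snd X)")
  case True
  \<comment> \<open>Since \<open>P\<^sub>1\<close> is complete, \<open>h H P\<^sub>1\<close> is the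
    number of edges of \<open>H\<close> by convention, which is also the value of
    \<open>hstar\<close> for independent variables.\<close>
  have complete: "edges P\<^sub>1 = part1 P\<^sub>1 \<times> part2 P\<^sub>1" by (simp add: P\<^sub>1_def)
  have "restrict id (verts P\<^sub>1) \<in> Aut P\<^sub>1"
    by (auto simp: Aut_def P\<^sub>1_def verts_def bij_betw_def)
  then have "edge_vertex_transitive P\<^sub>1"
    unfolding edge_vertex_transitive_def
    by (auto simp: P\<^sub>1_def verts_def intro!: bexI[of _ "restrict id (verts P\<^sub>1)"])
  moreover have "log_convergent (\<lambda>_. P\<^sub>1)"
    using P\<^sub>1_in_\<B>\<^sub>0 by (simp add: log_convergent_def convergent_const)
  moreover have "(\<lambda>i. h H P\<^sub>1) \<longlonglongrightarrow> hstar F1 F2 H X" for H :: "nat bigraph"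
    using True complete by (simp add: h_def hstar_def)
  ultimately show ?thesis by (intro exI[of _ "\<lambda>_. P\<^sub>1"]) simp
next
  case False
  obtain c1 :: "'a list \<Rightarrow> nat" and c2 :: "'b list \<Rightarrow> nat" where "type_graph F1 F2 c1 c2"
    using exists_type_graph[OF assms(1,2)] by metis
  then interpret type_graph F1 F2 c1 c2 .
  show ?thesis using assms(3) False by (rule exists_log_convergent_sequence)
qed

end
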